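(* Let $I\subset\mathbb{R}$ be a compact interval, let $\psi:\mathbb{N}\to\mathbb{R}^+$ be monotonic, and let $f:I\to\mathbb{R}$ be weakly non-degenerate. If $\sum_{q=1}^\infty\psi(q)\log q<\infty$, then $\mathcal{S}^*_f(\psi)$ has Lebesgue measure $0$.
   Context: For $x\in\mathbb{R}$, $\|x\|=\min_{k\in\mathbb{Z}}|x-k|$. $\mathcal{S}^*_f(\psi)$ is the set of $x\in I$ for which there are infinitely many $q\in\mathbb{N}$ with $\|qx\|\cdot\|qf(x)\|<\psi(q)$. For a compact interval $I_0$ and $0<c_1\le c_2$, $\mathcal{F}(I_0;c_1,c_2)$ is the set of $C^2$ functions $g:I_0\to\mathbb{R}$ with $c_1\le|g''|\le c_2$ on $I_0$, and $\overline{\mathcal{F}}(I_0;c_1,c_2)$ is its closure in $C(I_0)$ under the uniform norm. The function $f$ is weakly non-degenerate at $x_0\in I$ if there exist constants $c_2\ge c_1>0$ and a compact interval $I_0\subset I$ centered at $x_0$ with $f|_{I_0}\in\overline{\mathcal{F}}(I_0;c_1,c_2)$; $f$ is weakly non-degenerate if it is weakly non-degenerate at Lebesgue-almost every $x_0\in I$. *)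

theory Defs
  imports "HOL-Analysis.Analysis"
begin

text \<open>The infimum is attained, so it is the minimum over all integers.\<close>
definition dist_nearest_int :: "real \<Rightarrow> real"
  where "dist_nearest_int x = (INF k::int. \<bar>x - of_int k\<bar>)"

text \<open>Functions on a set are represented by extensional functions, as in the carrier of
  \<^const>\<open>cfunspace\<close>; derivatives at boundary points of \<open>I0\<close> are one-sided.\<close>
definition C2_class :: "real set \<Rightarrow> real \<Rightarrow> real \<Rightarrow> (real \<Rightarrow> real) set"
  where "C2_class I0 c1 c2 =
    {g \<in> extensional I0. \<exists>g' g''.
       (\<forall>x\<in>I0. (g has_real_derivative g' x) (at x within I0)) \<and>
       (\<forall>x\<in>I0. (g' has_real_derivative g'' x) (at x within I0)) \<and>
       continuous_on I0 g'' \<and>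
       (\<forall>x\<in>I0. c1 \<le> \<bar>g'' x\<bar> \<and> \<bar>g'' x\<bar> \<le> c2)}"

definition C2_class_closure :: "real set \<Rightarrow> real \<Rightarrow> real \<Rightarrow> (real \<Rightarrow> real) set"
  where "C2_class_closure I0 c1 c2 =
    mtopology_of (cfunspace (top_of_set I0) euclidean_metric) closure_of C2_class I0 c1 c2"

lemma C2_class_subset_cfunspace:
  assumes "compact I0"
  shows "C2_class I0 c1 c2 \<subseteq> mspace (cfunspace (top_of_set I0) euclidean_metric)"
proof -
  have "continuous_on I0 g" if "g \<in> C2_class I0 c1 c2" for g
    using that unfolding C2_class_def
    by (auto simp: continuous_on_eq_continuous_within intro: DERIV_continuous)
  moreover have "C2_class I0 c1 c2 \<subseteq> extensional I0"
    by (auto simp: C2_class_def)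
  ultimately show ?thesis
    using assms by (auto intro!: compact_imp_bounded compact_continuous_image)
qed

lemma C2_class_closure_iff:
  assumes "compact I0" "I0 \<noteq> {}"
  shows "restrict f I0 \<in> C2_class_closure I0 c1 c2 \<longleftrightarrow>
    continuous_on I0 f \<and> (\<forall>e>0. \<exists>g\<in>C2_class I0 c1 c2. \<forall>x\<in>I0. \<bar>f x - g x\<bar> \<le> e)"
proof -
  let ?C = "cfunspace (top_of_set I0) euclidean_metric :: (real \<Rightarrow> real) metric"
  interpret Metric_space "mspace ?C" "mdist ?C"
    by (rule Metric_space_mspace_mdist)
  have sub: "C2_class I0 c1 c2 \<subseteq> mspace ?C"
    by (rule C2_class_subset_cfunspace[OF assms(1)])
  have mem: "restrict f I0 \<in> mspace ?C \<longleftrightarrow> continuous_on I0 f"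
    using assms(1) by (auto intro!: compact_imp_bounded compact_continuous_image)
  have le: "mdist ?C (restrict f I0) g \<le> e \<longleftrightarrow> (\<forall>x\<in>I0. \<bar>f x - g x\<bar> \<le> e)"
    if "continuous_on I0 f" "g \<in> C2_class I0 c1 c2" for g e
    using cfunspace_mdist_le[of "restrict f I0" "top_of_set I0" euclidean_metric g e]
      that sub mem assms(2) by (auto simp: dist_real_def)
  have "restrict f I0 \<in> C2_class_closure I0 c1 c2 \<longleftrightarrow> restrict f I0 \<in> mspace ?C \<and>
      (\<forall>e>0. \<exists>g\<in>C2_class I0 c1 c2. mdist ?C (restrict f I0) g \<le> e)"
    using sub unfolding C2_class_closure_def mtopology_of_def metric_closure_of_alt
      mem_Collect_eq in_mcball
    by blast
  with mem le show ?thesis by auto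
qed

text \<open>The interval centred at \<open>x0\<close> must be non-degenerate: over a single point the condition
  would be void.\<close>
definition weakly_nondegenerate_at :: "real set \<Rightarrow> (real \<Rightarrow> real) \<Rightarrow> real \<Rightarrow> bool"
  where "weakly_nondegenerate_at I f x0 \<longleftrightarrow>
    (\<exists>c1 c2 r. 0 < c1 \<and> c1 \<le> c2 \<and> 0 < r \<and> {x0 - r..x0 + r} \<subseteq> I \<and>
       restrict f {x0 - r..x0 + r} \<in> C2_class_closure {x0 - r..x0 + r} c1 c2)"

definition weakly_nondegenerate :: "real set \<Rightarrow> (real \<Rightarrow> real) \<Rightarrow> bool"
  where "weakly_nondegenerate I f \<longleftrightarrow> (AE x0 in lebesgue_on I. weakly_nondegenerate_at I f x0)"

definition mult_approx_set :: "real set \<Rightarrow> (real \<Rightarrow> real) \<Rightarrow> (nat \<Rightarrow> real) \<Rightarrow> real set"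
  where "mult_approx_set I f \<psi> =
    {x \<in> I. infinite {q::nat. 1 \<le> q \<and>
       dist_nearest_int (real q * x) * dist_nearest_int (real q * f x) < \<psi> q}}"

end

theory Submission
  imports Defs
begin

text \<open>
  On a small interval, \<open>f\<close> or \<open>-f\<close> is a limit of uniformly convex \<open>C\<^sup>2\<close> functions, so it has a slope
  function \<open>h\<close> with second-order bounds from both sides; only these bounds are used. For
  \<open>q\<close> of size \<open>Q = 2^t\<close>, split the product condition dyadically into \<open>\<parallel>q x\<parallel>\<close> at most a multiple of
  \<open>\<psi> / \<delta>\<close> and \<open>\<parallel>q f(x)\<parallel> \<le> \<delta>\<close>, or vice versa, where \<open>\<delta> = 2^(-k)\<close> is at least the root of \<open>\<psi>\<close>. There are
  \<open>O(log Q)\<close> such splittings, so it is enough that each one contributes measure \<open>O(Q \<psi>(Q))\<close>, which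
  is the case if an arc of length \<open>\<rho> = (\<delta> / Q)^(1/2)\<close> contains \<open>O((Q \<delta>)^(3/2))\<close> distinct nearby rational
  points with denominators of size \<open>Q\<close>. Non-collinear triples of such points span triangles of area at
  least \<open>1 / (16 Q^3)\<close>, which gives the bound unless two of the points are very close together. In that
  case their cross product is a nonzero integer vector \<open>a\<close> for which \<open>a\<^sub>0 + a\<^sub>1 x + a\<^sub>2 f(x)\<close> and its
  derivative are both small. As \<open>\<psi>\<close> may be assumed to be at least \<open>q^(-10/9)\<close>, the set of \<open>x\<close>
  admitting such an \<open>a\<close> has measure \<open>O(t Q^(-1/36))\<close>: if two non-parallel \<open>a\<close> occur in a short arc, then
  their cross product shows that the arc is close to a rational number with small denominator.
  The Borel--Cantelli lemma concludes.
\<close>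

section \<open>Covering by sets of small Lebesgue measure\<close>

text \<open>Outer measure at most \<open>m\<close>, stated through a Borel superset, so that no set
  built from \<open>f\<close> has to be proved measurable.\<close>

definition covered :: "real set \<Rightarrow> real \<Rightarrow> bool"
  where "covered S m \<longleftrightarrow> (\<exists>W\<in>sets lborel. S \<subseteq> W \<and> emeasure lborel W \<le> ennreal m)"

lemma covered_mono: "covered S m \<Longrightarrow> T \<subseteq> S \<Longrightarrow> m \<le> n \<Longrightarrow> covered T n"
  unfolding covered_def by (meson ennreal_leI order_trans)

lemma covered_Un:
  assumes "covered S m" "covered T n" "0 \<le> m" "0 \<le> n"
  shows "covered (S \<union> T) (m + n)"
proof -
  obtain V W where "V \<in> sets lborel" "W \<in> sets lborel" "S \<subseteq> V" "T \<subseteq> W"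
    "emeasure lborel V \<le> ennreal m" "emeasure lborel W \<le> ennreal n"
    using assms unfolding covered_def by blast
  moreover have "emeasure lborel (V \<union> W) \<le> emeasure lborel V + emeasure lborel W"
    using \<open>V \<in> sets lborel\<close> \<open>W \<in> sets lborel\<close> by (rule emeasure_subadditive)
  moreover have "emeasure lborel V + emeasure lborel W \<le> ennreal m + ennreal n"
    using calculation by (intro add_mono)
  ultimately show ?thesis
    unfolding covered_def using assms by (intro bexI[of _ "V \<union> W"]) (auto simp: ennreal_plus)
qed

lemma covered_empty: "covered {} 0"
  unfolding covered_def by (intro bexI[of _ "{}"]) auto

lemma covered_UN:
  assumes "finite I" "\<And>i. i \<in> I \<Longrightarrow> covered (S i) m" "0 \<le> m" "real (card I) \<le> N"
  shows "covered (\<Union>i\<in>I. S i) (N * m)"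
proof -
  have "covered (\<Union>i\<in>I. S i) (real (card I) * m)"
    using assms(1,2)
  proof (induction I)
    case empty
    then show ?case by (simp add: covered_empty)
  next
    case (insert i I)
    have "covered (S i \<union> (\<Union>i\<in>I. S i)) (m + real (card I) * m)"
      using insert assms(3) by (intro covered_Un) auto
    then show ?case using insert by (simp add: algebra_simps)
  qed
  then show ?thesis
    by (rule covered_mono) (use assms in \<open>auto intro: mult_right_mono\<close>)
qed

text \<open>Any point of \<open>S\<close> serves as centre of an interval of radius
  \<open>d\<close>; the factor 2 lost against the diameter is harmless.\<close>

lemma covered_diameter:
  assumes "\<And>x y. x \<in> S \<Longrightarrow> y \<in> S \<Longrightarrow> \<bar>x - y\<bar> \<le> d" "0 \<le> d"
  shows "covered S (2 * d)"
proof (cases "S = {}")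
  case True
  then show ?thesis using covered_mono[OF covered_empty] assms by simp
next
  case False
  then obtain x where "x \<in> S" by auto
  then have "S \<subseteq> {x - d..x + d}" using assms(1) by (force simp: abs_le_iff)
  then show ?thesis unfolding covered_def using assms(2)
    by (intro bexI[of _ "{x - d..x + d}"]) (auto simp: algebra_simps)
qed

text \<open>Reduces an estimate on the whole interval to one on short arcs, multiplied by the number
  of arcs; this needs a bound that is uniform in \<open>u\<close>.\<close>

lemma covered_grid:
  assumes "0 < r" "\<alpha> \<le> \<beta>" "S \<subseteq> {\<alpha>..\<beta>}" "0 \<le> m"
    and "\<And>u. covered (S \<inter> {u..u + r}) m"
  shows "covered S (((\<beta> - \<alpha>) / r + 1) * m)"
proof -
  \<comment> \<open>Cells are indexed from 0 to \<open>n\<close>, so there are \<open>n + 1\<close>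
    of them; the last may stick out beyond \<open>\<beta>\<close>.\<close>
  define n where "n = nat \<lfloor>(\<beta> - \<alpha>) / r\<rfloor>"
  have n0: "0 \<le> (\<beta> - \<alpha>) / r" using assms by simp
  have n: "real n \<le> (\<beta> - \<alpha>) / r" "(\<beta> - \<alpha>) / r < real n + 1"
    using n0 unfolding n_def by (auto simp: of_nat_nat)
  have "S \<subseteq> (\<Union>i\<in>{..n}. S \<inter> {\<alpha> + real i * r..\<alpha> + real i * r + r})"
  proof
    fix x assume x: "x \<in> S"
    define i where "i = nat \<lfloor>(x - \<alpha>) / r\<rfloor>"
    have x0: "0 \<le> (x - \<alpha>) / r" "(x - \<alpha>) / r \<le> (\<beta> - \<alpha>) / r"
      using assms x by (auto simp: divide_right_mono)
    have i: "real i \<le> (x - \<alpha>) / r" "(x - \<alpha>) / r < real i + 1"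
      using x0 unfolding i_def by (auto simp: of_nat_nat)
    have "real i < real n + 1" using i(1) x0(2) n(2) by linarith
    then have "i \<le> n" by linarith
    moreover have "\<alpha> + real i * r \<le> x" "x \<le> \<alpha> + real i * r + r"
      using i assms(1) by (auto simp: field_simps)
    ultimately show "x \<in> (\<Union>i\<in>{..n}. S \<inter> {\<alpha> + real i * r..\<alpha> + real i * r + r})"
      using x by auto
  qed
  moreover have "covered (\<Union>i\<in>{..n}. S \<inter> {\<alpha> + real i * r..\<alpha> + real i * r + r}) (((\<beta> - \<alpha>) / r + 1) * m)"
    using assms n by (intro covered_UN) auto
  ultimately show ?thesis using covered_mono by blast
qed

text \<open>Borel-Cantelli for outer measure: it is applied to Borel supersets, and completeness of
  Lebesgue measure then makes \<open>T\<close> null.\<close>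

lemma covered_limsup_null:
  assumes "\<And>t. t \<ge> N \<Longrightarrow> covered (S t) (m t)" "summable m" "\<And>t. t \<ge> N \<Longrightarrow> 0 \<le> m t"
    and "\<And>x. x \<in> T \<Longrightarrow> infinite {t. x \<in> S t}"
  shows "T \<in> null_sets lebesgue"
proof -
  have "\<exists>W. \<forall>t\<ge>N. W t \<in> sets lborel \<and> S t \<subseteq> W t \<and> emeasure lborel (W t) \<le> ennreal (m t)"
    using assms(1) unfolding covered_def by metis
  then obtain W0 where W0: "\<And>t. t \<ge> N \<Longrightarrow> W0 t \<in> sets lborel" "\<And>t. t \<ge> N \<Longrightarrow> S t \<subseteq> W0 t"
      "\<And>t. t \<ge> N \<Longrightarrow> emeasure lborel (W0 t) \<le> ennreal (m t)" by metis
  define W where "W t = W0 (t + N)" for t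
  have W: "\<And>t. W t \<in> sets lborel" "\<And>t. S (t + N) \<subseteq> W t" "\<And>t. emeasure lborel (W t) \<le> ennreal (m (t + N))"
    using W0 unfolding W_def by auto
  have m0: "\<And>t. 0 \<le> m (t + N)" using assms(3) by simp
  have sm: "summable (\<lambda>t. m (t + N))" using assms(2) by (simp add: summable_iff_shift)
  have "limsup W \<in> null_sets lborel"
  proof (rule borel_cantelli_limsup1)
    show "emeasure lborel (W t) < \<infinity>" for t
      using W(3)[of t] by (metis ennreal_less_top infinity_ennreal_def le_less_trans)
    show "summable (\<lambda>t. measure lborel (W t))"
    proof (rule summable_comparison_test[OF _ sm], intro exI allI impI)
      fix t
      show "norm (measure lborel (W t)) \<le> m (t + N)"
        using W(3)[of t] m0[of t] unfolding measure_def
        by (simp add: enn2real_leI)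
    qed
  qed (use W in auto)
  then have "limsup W \<in> null_sets lebesgue" by (rule null_sets_completionI)
  moreover have "T \<subseteq> limsup W"
  proof
    fix x assume "x \<in> T"
    then have inf: "infinite {t. x \<in> S t}" by (rule assms(4))
    have "\<exists>t\<ge>n. x \<in> W t" for n
    proof -
      obtain s where "s \<ge> n + N" "x \<in> S s" using inf unfolding infinite_nat_iff_unbounded_le by auto
      then have "x \<in> W (s - N)" using W(2)[of "s - N"] by auto
      then show ?thesis using \<open>s \<ge> n + N\<close> by (intro exI[of _ "s - N"]) auto
    qed
    then show "x \<in> limsup W" unfolding limsup_INF_SUP by auto
  qed
  ultimately show ?thesis by (rule null_sets_completion_subset[rotated])
qed

text \<open>By Lindelof, countably many of the neighbourhoods already cover
  \<open>S\<close>.\<close>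

lemma locally_null:
  fixes S :: "real set"
  assumes "\<And>x. x \<in> S \<Longrightarrow> \<exists>U. open U \<and> x \<in> U \<and> S \<inter> U \<in> null_sets lebesgue"
  shows "S \<in> null_sets lebesgue"
proof -
  let ?F = "{U. open U \<and> S \<inter> U \<in> null_sets lebesgue}"
  obtain F' where F': "F' \<subseteq> ?F" "countable F'" "\<Union>F' = \<Union>?F"
    by (rule Lindelof[of ?F]) auto
  have "(\<Union>U\<in>F'. S \<inter> U) \<in> null_sets lebesgue"
    using F' by (intro null_sets_UN') auto
  moreover have "S \<subseteq> (\<Union>U\<in>F'. S \<inter> U)"
  proof
    fix x assume x: "x \<in> S"
    then have "x \<in> \<Union>?F" using assms by blast
    then show "x \<in> (\<Union>U\<in>F'. S \<inter> U)" using x unfolding F'(3)[symmetric] by blast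
  qed
  ultimately show ?thesis by (rule null_sets_completion_subset[rotated])
qed

text \<open>For fixed \<open>q\<close> there are O(\<open>q\<close>) numerators, each contributing
  O(\<open>e / q\<close>); the product does not depend on \<open>q\<close>, and there are at most
  \<open>N\<close> denominators.\<close>

lemma covered_near_rationals:
  assumes "\<alpha> \<le> \<beta>" "0 \<le> e" "e \<le> 1"  "0 \<le> N"
  shows "covered {y \<in> {\<alpha>..\<beta>}. \<exists>q p :: int. 1 \<le> q \<and> of_int q \<le> N \<and> \<bar>of_int q * y - of_int p\<bar> \<le> e}
    (N * (4 * (\<beta> - \<alpha> + 3) * e))"
proof -
  let ?I = "{1..\<lfloor>N\<rfloor>}"
  let ?T = "\<lambda>q :: int. {y \<in> {\<alpha>..\<beta>}. \<exists>p :: int. \<bar>of_int q * y - of_int p\<bar> \<le> e}"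
  have "covered (\<Union>q\<in>?I. ?T q) (N * (4 * (\<beta> - \<alpha> + 3) * e))"
  proof (rule covered_UN)
    fix q assume "q \<in> ?I"
    then have q: "1 \<le> q" by simp
    then have q1: "(1::real) \<le> of_int q" by simp
    \<comment> \<open>Every numerator within \<open>e\<close> of some \<open>q * y\<close>; as
      \<open>e \<le> 1\<close>, there are at most \<open>q * (\<beta> - \<alpha>) + 3\<close> of
      them.\<close>
    let ?P = "{\<lceil>of_int q * \<alpha> - e\<rceil>..\<lfloor>of_int q * \<beta> + e\<rfloor>}"
    have "covered (\<Union>p\<in>?P. {y. \<bar>of_int q * y - of_int p\<bar> \<le> e}) (of_int q * (\<beta> - \<alpha> + 3) * (2 * (2 * e / of_int q)))"
    proof (rule covered_UN)
      fix p :: int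
      show "covered {y. \<bar>of_int q * y - of_int p\<bar> \<le> e} (2 * (2 * e / of_int q))"
      proof (rule covered_diameter)
        fix x y assume "x \<in> {y. \<bar>of_int q * y - of_int p\<bar> \<le> e}" "y \<in> {y. \<bar>of_int q * y - of_int p\<bar> \<le> e}"
        then have "\<bar>of_int q * x - of_int q * y\<bar> \<le> 2 * e" by auto
        then have "of_int q * \<bar>x - y\<bar> \<le> 2 * e"
          using q by (simp add: abs_mult right_diff_distrib[symmetric])
        then show "\<bar>x - y\<bar> \<le> 2 * e / of_int q" using q by (simp add: field_simps)
      qed (use assms q in auto)
    next
      have "of_int \<lfloor>of_int q * \<beta> + e\<rfloor> \<le> of_int q * \<beta> + e" "of_int q * \<alpha> - e \<le> of_int \<lceil>of_int q * \<alpha> - e\<rceil>" by linarith+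
      then have "of_int (\<lfloor>of_int q * \<beta> + e\<rfloor> + 1 - \<lceil>of_int q * \<alpha> - e\<rceil>) \<le> of_int q * (\<beta> - \<alpha>) + 3"
        unfolding of_int_add of_int_diff right_diff_distrib using assms(3) by linarith
      moreover have "0 \<le> of_int q * (\<beta> - \<alpha>) + 3" using q assms by auto
      ultimately have "real (card ?P) \<le> of_int q * (\<beta> - \<alpha>) + 3"
        unfolding card_atLeastAtMost_int by (cases "0 \<le> \<lfloor>of_int q * \<beta> + e\<rfloor> + 1 - \<lceil>of_int q * \<alpha> - e\<rceil>") (simp_all only: of_nat_nat nat_le_0 of_nat_0)
      also have "\<dots> \<le> of_int q * (\<beta> - \<alpha> + 3)" using q1 by (simp add: algebra_simps)
      finally show "real (card ?P) \<le> of_int q * (\<beta> - \<alpha> + 3)" .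
    qed (use assms q in auto)
    moreover have "?T q \<subseteq> (\<Union>p\<in>?P. {y. \<bar>of_int q * y - of_int p\<bar> \<le> e})"
    proof
      fix y assume "y \<in> ?T q"
      then obtain p :: int where y: "y \<in> {\<alpha>..\<beta>}" "\<bar>of_int q * y - of_int p\<bar> \<le> e" by auto
      have "of_int q * \<alpha> \<le> of_int q * y" "of_int q * y \<le> of_int q * \<beta>"
        using y q1 by (auto intro!: mult_left_mono)
      then have "of_int q * \<alpha> - e \<le> of_int p" "of_int p \<le> of_int q * \<beta> + e" using y(2) by linarith+
      then have "p \<in> ?P" by (simp add: ceiling_le_iff le_floor_iff)
      then show "y \<in> (\<Union>p\<in>?P. {y. \<bar>of_int q * y - of_int p\<bar> \<le> e})" using y(2) by blast
    qed
    moreover have "of_int q * (\<beta> - \<alpha> + 3) * (2 * (2 * e / of_int q)) = 4 * (\<beta> - \<alpha> + 3) * e"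
      using q by (simp add: field_simps)
    ultimately show "covered (?T q) (4 * (\<beta> - \<alpha> + 3) * e)" using covered_mono by fastforce
  next
    have "real (card ?I) = of_int (max 0 \<lfloor>N\<rfloor>)" by (simp add: max_def of_nat_nat)
    then show "real (card ?I) \<le> N" using assms by (auto simp: max_def)
  qed (use assms in auto)
  then show ?thesis by (rule covered_mono) (force simp: le_floor_iff)+
qed

section \<open>Counting planar points by triangle areas\<close>

text \<open>Twice the signed area of the triangle; it vanishes exactly for collinear
  triples.\<close>

abbreviation tri :: "real \<times> real \<Rightarrow> real \<times> real \<Rightarrow> real \<times> real \<Rightarrow> real"
  where "tri P Q R \<equiv> (fst Q - fst P) * (snd R - snd P) - (snd Q - snd P) * (fst R - fst P)"

text \<open>The lexicographic order runs monotonically along every line, vertical ones included, so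
  the third point prolongs the segment of the first two and \<open>c\<close> is positive.\<close>

lemma collinear_lex_increasing:
  fixes P Q R :: "real \<times> real"
  assumes "tri P Q R = 0"
    and PQ: "fst P < fst Q \<or> fst P = fst Q \<and> snd P < snd Q"
    and QR: "fst Q < fst R \<or> fst Q = fst R \<and> snd Q < snd R"
  obtains c where "c > 0" "fst R = fst Q + c * (fst Q - fst P)" "snd R = snd Q + c * (snd Q - snd P)"
proof (cases "fst P = fst Q")
  case True
  then have "snd P < snd Q" using PQ by auto
  then have "fst R = fst P" using assms(1) True by simp
  then have "snd Q < snd R" using QR True by auto
  show ?thesis
    by (rule that[of "(snd R - snd Q) / (snd Q - snd P)"])
       (use True \<open>snd P < snd Q\<close> \<open>snd Q < snd R\<close> \<open>fst R = fst P\<close> in auto)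
next
  case False
  then have lt: "fst P < fst Q" using PQ by auto
  have "fst Q < fst R"
  proof (rule ccontr)
    assume "\<not> fst Q < fst R"
    then have "fst R = fst Q" "snd Q < snd R" using QR by auto
    then have "(fst Q - fst P) * (snd R - snd Q) = 0" using assms(1) by (simp add: algebra_simps)
    then show False using lt \<open>snd Q < snd R\<close> by auto
  qed
  show ?thesis
  proof (rule that[of "(fst R - fst Q) / (fst Q - fst P)"])
    have "(snd R - snd Q) * (fst Q - fst P) = (fst R - fst Q) * (snd Q - snd P)"
      using assms(1) by (simp add: algebra_simps)
    then show "snd R = snd Q + (fst R - fst Q) / (fst Q - fst P) * (snd Q - snd P)"
      using lt by (simp add: field_simps)
  qed (use lt \<open>fst Q < fst R\<close> in auto)
qed

text \<open>Two mechanisms bound the number of points. Broken collinear runs use up area, which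
  gives \<open>4 * H * L / \<kappa>\<close>. Along an unbroken run the separations in
  \<open>sep\<close> add up, so its length is at most \<open>a * L + b * H\<close>; this is paid
  only for the last run.\<close>

lemma triangle_count:
  fixes P :: "nat \<Rightarrow> real \<times> real"
  assumes lex: "\<And>i j. i < j \<Longrightarrow> j \<le> n \<Longrightarrow> fst (P i) < fst (P j) \<or> fst (P i) = fst (P j) \<and> snd (P i) < snd (P j)"
    and \<kappa>: "\<kappa> > 0" "\<And>i j k. i \<le> n \<Longrightarrow> j \<le> n \<Longrightarrow> k \<le> n \<Longrightarrow> tri (P i) (P j) (P k) \<noteq> 0 \<Longrightarrow> \<kappa> \<le> \<bar>tri (P i) (P j) (P k)\<bar>"
    and sep: "\<And>i j. i < j \<Longrightarrow> j \<le> n \<Longrightarrow> 1 \<le> a * \<bar>fst (P j) - fst (P i)\<bar> + b * \<bar>snd (P j) - snd (P i)\<bar>"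
    and ab: "a \<ge> 0" "b \<ge> 0"
    and L: "\<And>i j. i \<le> n \<Longrightarrow> j \<le> n \<Longrightarrow> \<bar>fst (P j) - fst (P i)\<bar> \<le> L"
    and H: "\<And>i j. i \<le> n \<Longrightarrow> j \<le> n \<Longrightarrow> \<bar>snd (P j) - snd (P i)\<bar> \<le> H"
  shows "real n \<le> 4 * H * L / \<kappa> + a * L + b * H"
proof -
  have mono: "fst (P i) \<le> fst (P j)" if "i \<le> j" "j \<le> n" for i j
    using lex[of i j] that by (cases "i = j") auto
  have H0: "H \<ge> 0" using H[of 0 0] by auto
  text \<open>Sweep from left to right; \<open>P i, \<dots>, P j\<close> is the current collinear run.  When the run is broken
    by \<open>P (Suc j)\<close>, the triangles on the edges of the run with apex \<open>P (Suc j)\<close> have total area at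
    least \<open>(j - i) * \<kappa> / 2\<close> and lie in a vertical strip; the strips of different runs overlap at most
    twice.\<close>
  have key: "real n - real i \<le> 2 * H / \<kappa> * (2 * fst (P n) - fst (P i) - fst (P (Suc i))) + a * L + b * H"
    if "i < j" "j \<le> n"
      "\<And>k. k \<le> n \<Longrightarrow> tri (P i) (P j) (P k) \<noteq> 0 \<Longrightarrow> (real j - real i) * \<kappa> \<le> \<bar>tri (P i) (P j) (P k)\<bar>"
      "real j - real i \<le> a * \<bar>fst (P j) - fst (P i)\<bar> + b * \<bar>snd (P j) - snd (P i)\<bar>"
    for i j
    using that
  \<comment> \<open>The induction is on the number of points not yet swept. The run carries two
    invariants: the area seen from any apex off its line, and the accumulated separation.\<close>
  proof (induction "n - j" arbitrary: i j)
    case 0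
    then have "j = n" by simp
    have "a * \<bar>fst (P j) - fst (P i)\<bar> + b * \<bar>snd (P j) - snd (P i)\<bar> \<le> a * L + b * H"
      using ab L[of i j] H[of i j] 0 by (intro add_mono mult_left_mono) auto
    moreover have "2 * H / \<kappa> * (2 * fst (P n) - fst (P i) - fst (P (Suc i))) \<ge> 0"
      using H0 \<kappa>(1) mono[of i n] mono[of "Suc i" n] 0 by (intro mult_nonneg_nonneg) auto
    ultimately show ?case using 0 \<open>j = n\<close> by linarith
  next
    case (Suc m)
    then have jn: "Suc j \<le> n" and m: "m = n - Suc j" by auto
    show ?case
    proof (cases "tri (P i) (P j) (P (Suc j)) = 0")
      case True
      obtain c where l: "c > 0" "fst (P (Suc j)) = fst (P j) + c * (fst (P j) - fst (P i))"
          "snd (P (Suc j)) = snd (P j) + c * (snd (P j) - snd (P i))"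
        using collinear_lex_increasing[OF True lex[OF Suc.prems(1,2)] lex[of j "Suc j"]] jn by auto
      show ?thesis
      proof (rule Suc.hyps(1)[OF m])
        fix k assume k: "k \<le> n" "tri (P i) (P (Suc j)) (P k) \<noteq> 0"
        let ?D = "tri (P i) (P j) (P k)"
        \<comment> \<open>The triangle over the extended run is the old one plus the one over the
          new edge, whose \<open>tri\<close> is at least \<open>\<kappa>\<close> in absolute
          value.\<close>
        have e1: "tri (P i) (P (Suc j)) (P k) = (1 + c) * ?D"
          unfolding l by (simp add: algebra_simps)
        have e2: "tri (P j) (P (Suc j)) (P k) = c * ?D"
          unfolding l by (simp add: algebra_simps)
        have D: "?D \<noteq> 0" using k e1 by auto
        have "\<kappa> \<le> \<bar>c * ?D\<bar>"
          using \<kappa>(2)[of j "Suc j" k] jn k(1) e2 D l(1) by auto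
        moreover have "(real j - real i) * \<kappa> \<le> \<bar>?D\<bar>" using Suc.prems(3)[OF k(1) D] .
        moreover have "\<bar>(1 + c) * ?D\<bar> = \<bar>?D\<bar> + \<bar>c * ?D\<bar>"
          using l(1) by (simp only: abs_mult) (simp add: distrib_right)
        ultimately show "(real (Suc j) - real i) * \<kappa> \<le> \<bar>tri (P i) (P (Suc j)) (P k)\<bar>"
          unfolding e1 by (simp add: algebra_simps)
      next
        let ?u = "\<bar>fst (P j) - fst (P i)\<bar>" and ?w = "\<bar>snd (P j) - snd (P i)\<bar>"
        have "fst (P (Suc j)) - fst (P i) = (1 + c) * (fst (P j) - fst (P i))"
          "snd (P (Suc j)) - snd (P i) = (1 + c) * (snd (P j) - snd (P i))"
          "fst (P (Suc j)) - fst (P j) = c * (fst (P j) - fst (P i))"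
          "snd (P (Suc j)) - snd (P j) = c * (snd (P j) - snd (P i))"
          unfolding l by (auto simp: algebra_simps)
        moreover have "\<bar>(1 + c) * z\<bar> = \<bar>z\<bar> + c * \<bar>z\<bar>" "\<bar>c * z\<bar> = c * \<bar>z\<bar>" for z
          using l(1) by (simp_all only: abs_mult) (simp_all add: distrib_right)
        ultimately have e: "\<bar>fst (P (Suc j)) - fst (P i)\<bar> = ?u + c * ?u"
          "\<bar>snd (P (Suc j)) - snd (P i)\<bar> = ?w + c * ?w"
          "\<bar>fst (P (Suc j)) - fst (P j)\<bar> = c * ?u" "\<bar>snd (P (Suc j)) - snd (P j)\<bar> = c * ?w"
          by metis+
        have "1 \<le> a * (c * ?u) + b * (c * ?w)"
          using sep[of j "Suc j"] jn unfolding e by simp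
        then show "real (Suc j) - real i \<le> a * \<bar>fst (P (Suc j)) - fst (P i)\<bar> + b * \<bar>snd (P (Suc j)) - snd (P i)\<bar>"
          using Suc.prems(4) unfolding e by (simp add: algebra_simps)
      qed (use Suc.prems jn in auto)
    next
      case False
      let ?R = "P (Suc j)"
      \<comment> \<open>The run is broken; the edge from \<open>P j\<close> to
        \<open>P (Suc j)\<close> starts the next one.\<close>
      have IH: "real n - real j \<le> 2 * H / \<kappa> * (2 * fst (P n) - fst (P j) - fst ?R) + a * L + b * H"
        by (rule Suc.hyps(1)[OF m])
           (use jn \<kappa>(2)[of j "Suc j"] sep[of j "Suc j"] in auto)
      have s: "fst (P i) \<le> fst (P j)" "fst (P j) \<le> fst ?R" "fst (P (Suc i)) \<le> fst (P j)"
        using mono Suc.prems jn by auto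
      have "(real j - real i) * \<kappa> \<le> \<bar>tri (P i) (P j) ?R\<bar>"
        using Suc.prems(3)[OF jn False] .
      also have "\<dots> \<le> \<bar>fst (P j) - fst (P i)\<bar> * \<bar>snd ?R - snd (P i)\<bar> + \<bar>snd (P j) - snd (P i)\<bar> * \<bar>fst ?R - fst (P i)\<bar>"
        by (metis abs_mult abs_triangle_ineq4)
      also have "\<dots> \<le> (fst ?R - fst (P i)) * H + H * (fst ?R - fst (P i))"
        using s H0 H[of i "Suc j"] H[of i j] Suc.prems jn
        by (intro add_mono mult_mono) auto
      finally have "real j - real i \<le> 2 * H / \<kappa> * (fst ?R - fst (P i))"
        using \<kappa>(1) by (simp add: field_simps)
      \<comment> \<open>Adding the strip from \<open>P i\<close> to \<open>?R\<close> to the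
        induction hypothesis cancels \<open>fst ?R\<close>, and
        \<open>fst (P (Suc i)) \<le> fst (P j)\<close> restores the shape of the claim. Two
        abscissae are subtracted in \<open>key\<close> to allow for the double overlap of
        strips.\<close>
      moreover have "2 * H / \<kappa> * (2 * fst (P n) - fst (P i) - fst (P j)) \<le> 2 * H / \<kappa> * (2 * fst (P n) - fst (P i) - fst (P (Suc i)))"
        using s H0 \<kappa>(1) by (intro mult_left_mono) auto
      moreover define B where "B = 2 * H / \<kappa>"
      ultimately show ?thesis using IH unfolding B_def[symmetric] by (simp add: algebra_simps)
    qed
  qed
  have L0: "L \<ge> 0" using L[of 0 0] by auto
  show ?thesis
  proof (cases "n = 0")
    case True
    then show ?thesis using H0 L0 \<kappa>(1) ab by auto
  next
    case False
    have "real n - real 0 \<le> 2 * H / \<kappa> * (2 * fst (P n) - fst (P 0) - fst (P (Suc 0))) + a * L + b * H"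
      by (rule key[of 0 "Suc 0"]) (use False \<kappa>(2)[of 0 "Suc 0"] sep[of 0 "Suc 0"] in auto)
    moreover have "2 * H / \<kappa> * (2 * fst (P n) - fst (P 0) - fst (P (Suc 0))) \<le> 2 * H / \<kappa> * (2 * L)"
      using L[of 0 n] L[of 1 n] False H0 \<kappa>(1) by (intro mult_left_mono) auto
    ultimately show ?thesis by (simp add: algebra_simps)
  qed
qed

text \<open>Sorting \<open>S\<close> lexicographically makes \<open>triangle_count\<close>
  applicable; the extra 1 is the difference between points and gaps.\<close>

lemma card_le_of_triangles:
  fixes S :: "(real \<times> real) set"
  assumes "finite S"
    and \<kappa>: "\<kappa> > 0" "\<And>P Q R. P \<in> S \<Longrightarrow> Q \<in> S \<Longrightarrow> R \<in> S \<Longrightarrow> tri P Q R \<noteq> 0 \<Longrightarrow> \<kappa> \<le> \<bar>tri P Q R\<bar>"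
    and sep: "\<And>P Q. P \<in> S \<Longrightarrow> Q \<in> S \<Longrightarrow> P \<noteq> Q \<Longrightarrow> 1 \<le> a * \<bar>fst Q - fst P\<bar> + b * \<bar>snd Q - snd P\<bar>"
    and ab: "a \<ge> 0" "b \<ge> 0"
    and L: "\<And>P Q. P \<in> S \<Longrightarrow> Q \<in> S \<Longrightarrow> \<bar>fst Q - fst P\<bar> \<le> L"
    and H: "\<And>P Q. P \<in> S \<Longrightarrow> Q \<in> S \<Longrightarrow> \<bar>snd Q - snd P\<bar> \<le> H"
    and "0 \<le> L" "0 \<le> H"
  shows "real (card S) \<le> 1 + 4 * H * L / \<kappa> + a * L + b * H"
proof (cases "S = {}")
  case True
  then show ?thesis using assms by simp
next
  case False
  let ?lt = "\<lambda>p q :: real \<times> real. fst p < fst q \<or> fst p = fst q \<and> snd p < snd q"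
  interpret lex: linorder "\<lambda>p q. ?lt p q \<or> p = q" ?lt
    by standard (auto simp: prod_eq_iff)
  define n where "n = card S - 1"
  have "\<exists>xs. set xs = S \<and> length xs = card S \<and> sorted_wrt ?lt xs"
    using assms(1)
  proof (induction S rule: lex.finite_linorder_max_induct)
    case empty
    then show ?case by auto
  next
    case (insert p S)
    then obtain xs where "set xs = S" "length xs = card S" "sorted_wrt ?lt xs" by blast
    then show ?case using insert
      by (intro exI[of _ "xs @ [p]"]) (force simp: sorted_wrt_append card_insert_if)
  qed
  then obtain xs where xs: "set xs = S" "length xs = card S" "sorted_wrt ?lt xs" by blast
  have "card S > 0" using False assms(1) by (simp add: card_gt_0_iff)
  then have n: "card S = Suc n" unfolding n_def by simp
  have mem: "xs ! i \<in> S" if "i \<le> n" for i using xs n that by (metis le_imp_less_Suc nth_mem)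
  have lt: "?lt (xs ! i) (xs ! j)" if "i < j" "j \<le> n" for i j
    using sorted_wrt_nth_less[OF xs(3) that(1)] xs(2) n that by auto
  have "real n \<le> 4 * H * L / \<kappa> + a * L + b * H"
  proof (rule triangle_count[where P = "\<lambda>i. xs ! i"])
    fix i j assume ij: "i < j" "j \<le> n"
    show "1 \<le> a * \<bar>fst (xs ! j) - fst (xs ! i)\<bar> + b * \<bar>snd (xs ! j) - snd (xs ! i)\<bar>"
      using lt[OF ij] by (intro sep mem) (use ij in auto)
  qed (use lt mem \<kappa> ab L H in auto)
  then show ?thesis using n by simp
qed

section \<open>Dyadic sums\<close>

lemma dist_nearest_int_attained:
  obtains k :: int where "dist_nearest_int x = \<bar>x - of_int k\<bar>" "dist_nearest_int x \<le> 1 / 2"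
proof -
  have "dist_nearest_int x = \<bar>x - of_int (round x)\<bar>"
    unfolding dist_nearest_int_def
  proof (rule cInf_eq_minimum)
    show "\<bar>x - of_int (round x)\<bar> \<in> range (\<lambda>k::int. \<bar>x - of_int k\<bar>)" by simp
    show "\<bar>x - of_int (round x)\<bar> \<le> z" if "z \<in> range (\<lambda>k::int. \<bar>x - of_int k\<bar>)" for z
      using that round_diff_minimal by auto
  qed
  moreover have "\<bar>x - of_int (round x)\<bar> \<le> 1 / 2"
    using of_int_round_abs_le[of x] by (simp add: abs_minus_commute)
  ultimately show ?thesis using that by metis
qed

lemma dist_nearest_int_minus: "dist_nearest_int (- x) = dist_nearest_int x"
proof -
  have "range (\<lambda>k::int. \<bar>- x - of_int k\<bar>) = range (\<lambda>k::int. \<bar>x - of_int k\<bar>)"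
  proof (rule set_eqI, rule iffI)
    fix z
    assume "z \<in> range (\<lambda>k::int. \<bar>- x - of_int k\<bar>)"
    then obtain k :: int where "z = \<bar>- x - of_int k\<bar>" by blast
    then have "z = \<bar>x - of_int (- k)\<bar>" by simp
    then show "z \<in> range (\<lambda>k::int. \<bar>x - of_int k\<bar>)" by blast
  next
    fix z
    assume "z \<in> range (\<lambda>k::int. \<bar>x - of_int k\<bar>)"
    then obtain k :: int where "z = \<bar>x - of_int k\<bar>" by blast
    then have "z = \<bar>- x - of_int (- k)\<bar>" by simp
    then show "z \<in> range (\<lambda>k::int. \<bar>- x - of_int k\<bar>)" by blast
  qed
  then show ?thesis unfolding dist_nearest_int_def by simp
qed

section \<open>Splitting a product condition into dyadic levels, and condensation of the
  series\<close>

lemma dyadic_bracket: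
  assumes "0 < e" "e \<le> (1 :: real)"
  obtains k :: nat where "e \<le> 1 / 2 ^ k" "1 / 2 ^ k < 2 * e"
proof -
  obtain n where "1 / e < 2 ^ n" using real_arch_pow[of 2 "1 / e"] by auto
  then have n: "1 / 2 ^ n < e" using assms by (simp add: field_simps)
  define m where "m = (LEAST n. 1 / 2 ^ n < e)"
  have m: "1 / 2 ^ m < e" unfolding m_def using n by (rule LeastI)
  then have "m \<noteq> 0" using assms by (intro notI) simp
  then obtain k where k: "m = Suc k" using not0_implies_Suc by blast
  then have "\<not> 1 / 2 ^ k < e" unfolding m_def by (metis lessI not_less_Least)
  then show ?thesis using m k by (intro that[of k]) (auto simp: field_simps)
qed

text \<open>\<open>1 / 2 ^ k\<close> brackets the larger factor \<open>d'\<close> from above, but is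
  never below the root of \<open>\<Psi>\<close>; this cut-off keeps the number of levels
  logarithmic.\<close>

lemma dyadic_split:
  fixes d d' \<Psi> :: real
  assumes "0 \<le> d" "d \<le> d'" "d' \<le> 1" "d * d' \<le> \<Psi>" "0 < \<Psi>" "\<Psi> \<le> 1"
  obtains k :: nat where "\<Psi> * 4 ^ k \<le> 1" "d' \<le> 1 / 2 ^ k" "d \<le> 2 * \<Psi> * 2 ^ k"
proof -
  define e where "e = max d' (sqrt \<Psi>)"
  have e: "0 < e" "e \<le> 1" unfolding e_def using assms by (auto simp: less_max_iff_disj)
  obtain k where k: "e \<le> 1 / 2 ^ k" "1 / 2 ^ k < 2 * e" using dyadic_bracket[OF e] .
  have "sqrt \<Psi> \<le> 1 / 2 ^ k" using k unfolding e_def by simp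
  then have "(sqrt \<Psi>)\<^sup>2 \<le> (1 / 2 ^ k)\<^sup>2" using assms by (intro power_mono) auto
  then have "\<Psi> \<le> 1 / 4 ^ k" using assms by (simp add: power_divide power2_eq_square[of "2 ^ k"] power_mult_distrib[symmetric])
  then have 1: "\<Psi> * 4 ^ k \<le> 1" by (simp add: field_simps)
  \<comment> \<open>If \<open>e\<close> is the root of \<open>\<Psi>\<close>, then
    \<open>d \<le> d'\<close> does not exceed it either; otherwise \<open>e = d'\<close>.\<close>
  have "d * e \<le> \<Psi>"
  proof (cases "d' \<le> sqrt \<Psi>")
    case True
    then have "d * sqrt \<Psi> \<le> sqrt \<Psi> * sqrt \<Psi>" using assms by (intro mult_right_mono) auto
    then show ?thesis using True assms unfolding e_def by (simp add: max_def)
  next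
    case False
    then show ?thesis using assms unfolding e_def by (simp add: max_def)
  qed
  then have "(d * e) * (2 * 2 ^ k) \<le> \<Psi> * (2 * 2 ^ k)" by (intro mult_right_mono) auto
  moreover have "d * 1 \<le> d * (2 * e * 2 ^ k)"
    using k(2) assms(1) by (intro mult_left_mono) (auto simp: field_simps)
  ultimately have "d \<le> 2 * \<Psi> * 2 ^ k" by (simp only: mult_1_right mult_ac)
  moreover have "d' \<le> 1 / 2 ^ k" using k(1) unfolding e_def by simp
  ultimately show ?thesis using 1 that by blast
qed

text \<open>Cauchy condensation, where the logarithm becomes a multiple of \<open>t\<close>. The
  factor \<open>t + 1\<close> will count the levels of a dyadic block.\<close>

lemma summable_dyadic:
  fixes \<psi> :: "nat \<Rightarrow> real"
  assumes pos: "\<And>q. 1 \<le> q \<Longrightarrow> 0 < \<psi> q" and mono: "antimono_on {1..} \<psi>"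
    and sum: "summable (\<lambda>n. \<psi> (Suc n) * ln (real (Suc n)))"
  shows "summable (\<lambda>t. real (t + 1) * 2 ^ t * \<psi> (2 ^ t))"
proof -
  let ?g = "\<lambda>n. \<psi> (Suc n) * ln (real (Suc n))"
  have g0: "0 \<le> ?g n" for n using pos[of "Suc n"] by (intro mult_nonneg_nonneg) auto
  have block: "2 ^ s * (real s * ln 2) * \<psi> (2 ^ Suc s) \<le> (\<Sum>n\<in>{2 ^ s..<2 ^ Suc s}. ?g n)" for s
  proof -
    have "real (card {2 ^ s..<2 ^ Suc s :: nat}) * (\<psi> (2 ^ Suc s) * (real s * ln 2)) \<le> (\<Sum>n\<in>{2 ^ s..<2 ^ Suc s}. ?g n)"
    proof (rule sum_bounded_below)
      fix n :: nat assume n: "n \<in> {2 ^ s..<2 ^ Suc s}"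
      have "\<psi> (2 ^ Suc s) \<le> \<psi> (Suc n)"
        using n by (intro monotone_onD[OF mono]) auto
      moreover have "real s * ln 2 = ln (2 ^ s)" by (simp add: ln_realpow)
      moreover have "2 ^ s \<le> Suc n" using n by simp
      then have "real (2 ^ s) \<le> real (Suc n)" by (simp only: of_nat_le_iff)
      then have "(2::real) ^ s \<le> real (Suc n)" by (simp only: of_nat_power of_nat_numeral)
      then have "ln (2 ^ s) \<le> ln (real (Suc n))" by (subst ln_le_cancel_iff) auto
      ultimately show "\<psi> (2 ^ Suc s) * (real s * ln 2) \<le> ?g n"
        using pos[of "Suc n"] by (simp only:) (intro mult_mono, auto)
    qed
    then show ?thesis by (simp add: mult_ac)
  qed
  have part: "(\<Sum>s<S. 2 ^ s * (real s * ln 2) * \<psi> (2 ^ Suc s)) \<le> (\<Sum>n<2 ^ S. ?g n)" for S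
  proof (induction S)
    case 0
    then show ?case using g0[of 0] by simp
  next
    case (Suc S)
    have "(\<Sum>n<2 ^ Suc S. ?g n) = (\<Sum>n<2 ^ S. ?g n) + (\<Sum>n\<in>{2 ^ S..<2 ^ Suc S}. ?g n)"
      unfolding lessThan_atLeast0 by (rule sum.atLeastLessThan_concat[symmetric]) simp_all
    then show ?case using Suc block[of S] by simp
  qed
  have "summable (\<lambda>s. 2 ^ s * (real s * ln 2) * \<psi> (2 ^ Suc s))"
  proof (rule summableI_nonneg_bounded)
    show "0 \<le> 2 ^ s * (real s * ln 2) * \<psi> (2 ^ Suc s)" for s
      using pos[of "2 ^ Suc s"] by (intro mult_nonneg_nonneg) auto
    show "(\<Sum>s<S. 2 ^ s * (real s * ln 2) * \<psi> (2 ^ Suc s)) \<le> suminf ?g" for S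
      using part[of S] sum_le_suminf[OF sum, of "{..<2 ^ S}"] g0 by force
  qed
  \<comment> \<open>The 6 comes from \<open>2 * (s + 2) \<le> 6 * s\<close> for
    \<open>s \<ge> 1\<close>, and \<open>ln 2\<close> from the logarithm of
    \<open>2 ^ s\<close>.\<close>
  then have "summable (\<lambda>s. 6 / ln 2 * (2 ^ s * (real s * ln 2) * \<psi> (2 ^ Suc s)))"
    by (rule summable_mult)
  then have "summable (\<lambda>s. real (Suc s + 1) * 2 ^ Suc s * \<psi> (2 ^ Suc s))"
  proof (rule summable_comparison_test'[where N = 1])
    fix s :: nat assume s: "s \<ge> 1"
    have p: "0 < \<psi> (2 ^ Suc s)" using pos[of "2 ^ Suc s"] by auto
    have "real (Suc s + 1) * 2 \<le> 6 * real s" using s by simp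
    then have "real (Suc s + 1) * 2 * (2 ^ s * \<psi> (2 ^ Suc s)) \<le> 6 * real s * (2 ^ s * \<psi> (2 ^ Suc s))"
      using p by (intro mult_right_mono) auto
    then show "norm (real (Suc s + 1) * 2 ^ Suc s * \<psi> (2 ^ Suc s)) \<le> 6 / ln 2 * (2 ^ s * (real s * ln 2) * \<psi> (2 ^ Suc s))"
      using p by (simp add: mult_ac abs_mult)
  qed
  then show ?thesis by (subst summable_Suc_iff[symmetric])
qed

section \<open>Rational points near a convex arc\<close>

text \<open>\<open>h\<close> stands for the derivative, and the bounds express a second derivative
  between \<open>c1\<close> and \<open>c2\<close>. In this form they pass to uniform limits, where a
  second derivative need not exist.\<close>

locale convex_arc =
  fixes f h :: "real \<Rightarrow> real" and \<alpha> \<beta> c1 c2 :: real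
  assumes le: "\<alpha> \<le> \<beta>" and c1: "0 < c1" and c12: "c1 \<le> c2"
    and lower: "\<And>x y. x \<in> {\<alpha>..\<beta>} \<Longrightarrow> y \<in> {\<alpha>..\<beta>} \<Longrightarrow> h x * (y - x) + c1 / 2 * (y - x)\<^sup>2 \<le> f y - f x"
    and upper: "\<And>x y. x \<in> {\<alpha>..\<beta>} \<Longrightarrow> y \<in> {\<alpha>..\<beta>} \<Longrightarrow> f y - f x \<le> h x * (y - x) + c2 / 2 * (y - x)\<^sup>2"
begin

text \<open>Adding the bounds for \<open>(x, y)\<close> and for \<open>(y, x)\<close> cancels
  \<open>f\<close>.\<close>

lemma slope_lipschitz:
  assumes "x \<in> {\<alpha>..\<beta>}" "y \<in> {\<alpha>..\<beta>}"
  shows "\<bar>h y - h x\<bar> \<le> c2 * \<bar>y - x\<bar>"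
proof -
  have 1: "(h y - h x) * (y - x) \<le> c2 * (y - x)\<^sup>2"
    using upper[OF assms] upper[OF assms(2,1)] by (simp add: algebra_simps power2_eq_square)
  have "0 \<le> c1 * (y - x)\<^sup>2" using c1 by simp
  then have "0 \<le> (h y - h x) * (y - x)"
    using lower[OF assms] lower[OF assms(2,1)] by (simp add: algebra_simps power2_eq_square)
  then have "\<bar>h y - h x\<bar> * \<bar>y - x\<bar> \<le> c2 * \<bar>y - x\<bar> * \<bar>y - x\<bar>"
    using 1 by (simp add: abs_mult[symmetric] power2_eq_square)
  then show ?thesis
    by (cases "y = x") (auto simp: mult_le_cancel_right)
qed

lemma taylor:
  assumes "x \<in> {\<alpha>..\<beta>}" "y \<in> {\<alpha>..\<beta>}"
  shows "\<bar>f y - f x - h x * (y - x)\<bar> \<le> c2 / 2 * (y - x)\<^sup>2"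
proof -
  have "0 \<le> c1 / 2 * (y - x)\<^sup>2" "0 \<le> c2 / 2 * (y - x)\<^sup>2" using c1 c12 by auto
  then show ?thesis using lower[OF assms] upper[OF assms] by linarith
qed

definition M :: real
  where "M = \<bar>h \<alpha>\<bar> + c2 * (\<beta> - \<alpha>)"

lemma slope:
  assumes "x \<in> {\<alpha>..\<beta>}"
  shows "\<bar>h x\<bar> \<le> M"
proof -
  have "c2 * \<bar>x - \<alpha>\<bar> \<le> c2 * (\<beta> - \<alpha>)" using assms c1 c12 by (intro mult_left_mono) auto
  then show ?thesis unfolding M_def using slope_lipschitz[of \<alpha> x] assms le by auto
qed

text \<open>The thresholds for \<open>a\<close> are those of the cross product of two close rational points with
  denominators of size \<open>Q\<close> in an arc of length \<open>\<rho>\<close>; in terms of \<open>\<delta> = Q \<rho>\<^sup>2\<close> they are \<open>1 / Q\<close>,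
  \<open>(Q \<delta>)^(-1/2)\<close> and \<open>1 / \<delta>\<close>.\<close>
definition generic :: "real \<Rightarrow> real \<Rightarrow> real \<Rightarrow> bool"
  where "generic Q \<rho> x \<longleftrightarrow> (\<forall>a0 a1 a2 :: int.
    \<bar>of_int a0 + of_int a1 * x + of_int a2 * f x\<bar> \<le> 1 / Q \<longrightarrow>
    \<bar>of_int a1 + of_int a2 * h x\<bar> \<le> 1 / (Q * \<rho>) \<longrightarrow> \<bar>of_int a2\<bar> \<le> 1 / (Q * \<rho>\<^sup>2) \<longrightarrow>
    a0 = 0 \<and> a1 = 0 \<and> a2 = 0)"

text \<open>A set of points, not of triples: a point counts once, however many denominators
  represent it.\<close>

definition rational_points :: "real \<Rightarrow> (real \<times> real) set"
  where "rational_points Q =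
    {(of_int p1 / of_int q, of_int p2 / of_int q) | p1 p2 q :: int. Q \<le> of_int q \<and> of_int q < 2 * Q}"

text \<open>Multiplied by the three denominators, \<open>tri\<close> becomes the determinant of the
  integer vectors \<open>(q, p1, p2)\<close>. A nonzero one is at least 1 in absolute value, and the
  denominators are below \<open>2 * Q\<close>.\<close>

lemma tri_rational_points:
  assumes "0 < Q" "P \<in> rational_points Q" "P' \<in> rational_points Q" "P'' \<in> rational_points Q"
    and "tri P P' P'' \<noteq> 0"
  shows "1 / (8 * Q ^ 3) \<le> \<bar>tri P P' P''\<bar>"
proof -
  obtain p1 p2 q where P: "P = (of_int p1 / of_int q, of_int p2 / of_int q)" "Q \<le> of_int q" "of_int q < 2 * Q"
    using assms(2) unfolding rational_points_def by auto
  obtain p1' p2' q' where P': "P' = (of_int p1' / of_int q', of_int p2' / of_int q')" "Q \<le> of_int q'" "of_int q' < 2 * Q"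
    using assms(3) unfolding rational_points_def by auto
  obtain p1'' p2'' q'' where P'': "P'' = (of_int p1'' / of_int q'', of_int p2'' / of_int q'')" "Q \<le> of_int q''" "of_int q'' < 2 * Q"
    using assms(4) unfolding rational_points_def by auto
  have q: "(0::real) < of_int q" "(0::real) < of_int q'" "(0::real) < of_int q''" using P P' P'' assms(1) by linarith+
  define d where "d = q * (p1' * p2'' - p2' * p1'') - p1 * (q' * p2'' - p2' * q'') + p2 * (q' * p1'' - p1' * q'')"
  have d: "of_int d = of_int q * of_int q' * of_int q'' * tri P P' P''"
    unfolding d_def P P' P'' using q by (simp add: divide_simps) (simp add: algebra_simps)
  have "d \<noteq> 0" using d q assms(5) by auto
  then have "1 \<le> \<bar>d\<bar>" by linarith
  then have "1 \<le> \<bar>of_int d :: real\<bar>" by linarith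
  also have "\<dots> = of_int q * of_int q' * of_int q'' * \<bar>tri P P' P''\<bar>"
    unfolding d using q by (simp add: abs_mult del: fst_conv snd_conv)
  also have "\<dots> \<le> ((2 * Q) * (2 * Q) * (2 * Q)) * \<bar>tri P P' P''\<bar>"
    using P P' P'' q by (intro mult_right_mono mult_mono) auto
  finally show ?thesis using assms(1) by (simp add: field_simps power3_eq_cube)
qed

text \<open>If the points were too close, the cross product of their integer vectors
  \<open>(q, p1, p2)\<close> would fall below the thresholds of \<open>generic\<close> and vanish,
  forcing the points to coincide. In \<open>c\<close>, the 4 comes from
  \<open>q * q' \<le> 4 * Q ^ 2\<close>, the 3 and \<open>C\<close> from the position of
  \<open>P\<close> relative to the tangent at \<open>x\<close>.\<close>

lemma generic_separated:
  fixes C c :: real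
  assumes "1 \<le> Q" "0 < \<rho>" "generic Q \<rho> x" "0 \<le> C" "c = 4 * (3 + C)"
    and P: "P \<in> rational_points Q" "\<bar>fst P - x\<bar> \<le> 3 * \<rho>"
      "\<bar>snd P - f x - h x * (fst P - x)\<bar> \<le> C * \<rho>\<^sup>2"
    and P': "P' \<in> rational_points Q" "P \<noteq> P'"
  shows "1 \<le> c * Q ^ 3 * \<rho>\<^sup>2 * \<bar>fst P' - fst P\<bar> +
    c * Q ^ 3 * \<rho> * \<bar>(snd P' - h x * fst P') - (snd P - h x * fst P)\<bar>"
proof (rule ccontr)
  assume neg: "\<not> ?thesis"
  let ?s = "fst P' - fst P" and ?w = "(snd P' - h x * fst P') - (snd P - h x * fst P)"
  obtain p1 p2 q where Pe: "P = (of_int p1 / of_int q, of_int p2 / of_int q)" "Q \<le> of_int q" "of_int q < 2 * Q"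
    using P(1) unfolding rational_points_def by auto
  obtain p1' p2' q' where Pe': "P' = (of_int p1' / of_int q', of_int p2' / of_int q')" "Q \<le> of_int q'" "of_int q' < 2 * Q"
    using P'(1) unfolding rational_points_def by auto
  have c: "c \<ge> 4" "c > 0" "12 + 4 * C = c" using assms by auto
  have nn: "0 \<le> c * Q ^ 3 * \<rho>\<^sup>2 * \<bar>?s\<bar>" "0 \<le> c * Q ^ 3 * \<rho> * \<bar>?w\<bar>" using assms c by auto
  have "c * Q ^ 3 * \<rho>\<^sup>2 * \<bar>?s\<bar> \<le> 1" using neg nn by linarith
  then have "4 / (c * Q * \<rho>\<^sup>2) * (c * Q ^ 3 * \<rho>\<^sup>2 * \<bar>?s\<bar>) \<le> 4 / (c * Q * \<rho>\<^sup>2) * 1"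
    using c assms(1,2) by (intro mult_left_mono) auto
  then have s: "4 * Q\<^sup>2 * \<bar>?s\<bar> \<le> 4 / (c * Q * \<rho>\<^sup>2)"
    using assms(1,2) c(2) by (simp add: power3_eq_cube power2_eq_square)
  have "c * Q ^ 3 * \<rho> * \<bar>?w\<bar> \<le> 1" using neg nn by linarith
  then have "4 / (c * Q * \<rho>) * (c * Q ^ 3 * \<rho> * \<bar>?w\<bar>) \<le> 4 / (c * Q * \<rho>) * 1"
    using c assms(1,2) by (intro mult_left_mono) auto
  then have w: "4 * Q\<^sup>2 * \<bar>?w\<bar> \<le> 4 / (c * Q * \<rho>)"
    using assms(1,2) c(2) by (simp add: power3_eq_cube power2_eq_square)
  have q: "(0::real) < of_int q" "(0::real) < of_int q'" using Pe Pe' assms(1) by linarith+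
  have qq: "of_int q * of_int q' \<le> 4 * Q\<^sup>2" "(0::real) < of_int q * of_int q'"
    using mult_mono[of "of_int q" "2 * Q" "of_int q'" "2 * Q"] Pe Pe' q by (auto simp: power2_eq_square)
  have m4: "\<bar>of_int q * of_int q' * z\<bar> \<le> 4 * Q\<^sup>2 * \<bar>z\<bar>" for z :: real
    unfolding abs_mult[of "of_int q * of_int q'"] using qq by (intro mult_right_mono) auto
  define a0 where "a0 = p1 * p2' - p2 * p1'"
  define a1 where "a1 = p2 * q' - q * p2'"
  define a2 where "a2 = q * p1' - p1 * q'"
  have e2: "of_int a2 = of_int q * of_int q' * ?s"
    unfolding a2_def Pe Pe' using q by (simp add: field_simps)
  have e1: "of_int a1 + of_int a2 * h x = - (of_int q * of_int q' * ?w)"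
    unfolding a2_def a1_def Pe Pe' using q by (simp add: divide_simps) (simp add: algebra_simps)
  have e0: "of_int a0 + of_int a1 * x + of_int a2 * f x =
      of_int q * of_int q' * ((fst P - x) * ?w - (snd P - f x - h x * (fst P - x)) * ?s)"
    unfolding a2_def a1_def a0_def Pe Pe' using q by (simp add: divide_simps) (simp add: algebra_simps)
  have c4: "4 / (c * Q * z) \<le> 1 / (Q * z)" if "0 < z" for z
  proof -
    have "4 / c * (1 / (Q * z)) \<le> 1 * (1 / (Q * z))"
      using c assms(1) that by (intro mult_right_mono) auto
    then show ?thesis by (simp add: mult.assoc)
  qed
  have b2: "\<bar>of_int a2\<bar> \<le> 1 / (Q * \<rho>\<^sup>2)"
  proof -
    have "\<bar>of_int a2\<bar> \<le> 4 / (c * Q * \<rho>\<^sup>2)"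
      unfolding e2 using m4[of ?s] s by (rule order_trans)
    also have "\<dots> \<le> 1 / (Q * \<rho>\<^sup>2)" using assms(2) by (intro c4) simp
    finally show ?thesis .
  qed
  have b1: "\<bar>of_int a1 + of_int a2 * h x\<bar> \<le> 1 / (Q * \<rho>)"
  proof -
    have "\<bar>of_int a1 + of_int a2 * h x\<bar> \<le> 4 / (c * Q * \<rho>)"
      unfolding e1 abs_minus_cancel using m4[of ?w] w by (rule order_trans)
    also have "\<dots> \<le> 1 / (Q * \<rho>)" using assms(2) by (rule c4)
    finally show ?thesis .
  qed
  have b0: "\<bar>of_int a0 + of_int a1 * x + of_int a2 * f x\<bar> \<le> 1 / Q"
  proof -
    have "\<bar>of_int a0 + of_int a1 * x + of_int a2 * f x\<bar> \<le>
        4 * Q\<^sup>2 * \<bar>(fst P - x) * ?w - (snd P - f x - h x * (fst P - x)) * ?s\<bar>"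
      unfolding e0 by (rule m4)
    also have "\<dots> \<le> 4 * Q\<^sup>2 * (\<bar>fst P - x\<bar> * \<bar>?w\<bar> + \<bar>snd P - f x - h x * (fst P - x)\<bar> * \<bar>?s\<bar>)"
      by (intro mult_left_mono) (metis abs_mult abs_triangle_ineq4, simp)
    also have "\<dots> \<le> 4 * Q\<^sup>2 * (3 * \<rho> * \<bar>?w\<bar> + C * \<rho>\<^sup>2 * \<bar>?s\<bar>)"
      using P by (intro mult_left_mono add_mono mult_right_mono) auto
    also have "\<dots> = 3 * \<rho> * (4 * Q\<^sup>2 * \<bar>?w\<bar>) + C * \<rho>\<^sup>2 * (4 * Q\<^sup>2 * \<bar>?s\<bar>)"
      by (simp add: algebra_simps)
    also have "\<dots> \<le> 3 * \<rho> * (4 / (c * Q * \<rho>)) + C * \<rho>\<^sup>2 * (4 / (c * Q * \<rho>\<^sup>2))"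
      using s w assms(1,2,4) by (intro add_mono mult_left_mono) auto
    also have "\<dots> = (12 + 4 * C) / (c * Q)"
      using assms(1,2) c(2) by (simp add: add_divide_distrib)
    also have "\<dots> = 1 / Q" unfolding c(3) using c(2) by simp
    finally show ?thesis .
  qed
  have z: "a1 = 0" "a2 = 0"
    using assms(3) b0 b1 b2 unfolding generic_def by blast+
  have "?s = 0" using e2 z qq(2) by auto
  moreover have "?w = 0" using e1 z qq(2) by auto
  ultimately have "P = P'" by (auto simp: prod_eq_iff)
  then show False using P' by simp
qed

text \<open>The constants of \<open>card_le_of_triangles\<close> for width
  \<open>6 * \<rho>\<close>, height \<open>2 * C * \<rho> ^ 2\<close> and
  \<open>\<kappa> = 1 / (8 * Q ^ 3)\<close>; in particular 384 is the product of 4, 2, 6 and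
  8.\<close>

definition arc_const :: "real \<Rightarrow> real"
  where "arc_const C = 1 + 384 * C + (6 + 2 * C) * (4 * (3 + C))"

text \<open>The shear \<open>g\<close> along the tangent slope at \<open>x\<close> preserves areas
  and flattens the arc into a box. Every term of the triangle count is then of order
  \<open>(Q * \<rho>) ^ 3\<close>, which also absorbs the 1 because
  \<open>1 \<le> Q * \<rho>\<close>.\<close>

lemma card_rational_points_le:
  assumes "1 \<le> Q" "0 < \<rho>" "1 \<le> Q * \<rho>" "generic Q \<rho> x" "0 \<le> C"
    and "finite S" "S \<subseteq> rational_points Q"
    and S: "\<And>P. P \<in> S \<Longrightarrow> \<bar>fst P - x\<bar> \<le> 3 * \<rho>"
      "\<And>P. P \<in> S \<Longrightarrow> \<bar>snd P - f x - h x * (fst P - x)\<bar> \<le> C * \<rho>\<^sup>2"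
  shows "real (card S) \<le> arc_const C * (Q * \<rho>) ^ 3"
proof -
  define c where "c = 4 * (3 + C)"
  define g where "g P = (fst P, snd P - h x * fst P)" for P :: "real \<times> real"
  have inj: "inj_on g S" unfolding g_def by (auto simp: inj_on_def)
  have tri_g: "tri (g P) (g P') (g P'') = tri P P' P''" for P P' P''
    unfolding g_def by (simp add: algebra_simps)
  have "real (card (g ` S)) \<le> 1 + 4 * (2 * (C * \<rho>\<^sup>2)) * (6 * \<rho>) / (1 / (8 * Q ^ 3)) + c * Q ^ 3 * \<rho>\<^sup>2 * (6 * \<rho>) + c * Q ^ 3 * \<rho> * (2 * (C * \<rho>\<^sup>2))"
  proof (rule card_le_of_triangles)
    fix P Q' R assume "P \<in> g ` S" "Q' \<in> g ` S" "R \<in> g ` S" "tri P Q' R \<noteq> 0"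
    then obtain P0 Q0 R0 where e: "P = g P0" "Q' = g Q0" "R = g R0" "P0 \<in> S" "Q0 \<in> S" "R0 \<in> S"
      by blast
    have "tri P0 Q0 R0 \<noteq> 0" using \<open>tri P Q' R \<noteq> 0\<close> unfolding e(1-3) tri_g .
    show "1 / (8 * Q ^ 3) \<le> \<bar>tri P Q' R\<bar>"
      unfolding e(1-3) tri_g
      by (rule tri_rational_points[OF _ _ _ _ \<open>tri P0 Q0 R0 \<noteq> 0\<close>])
         (use assms(1) in simp, (rule subsetD[OF assms(7)], fact)+)
  next
    fix P P' assume "P \<in> g ` S" "P' \<in> g ` S"
    then obtain P0 P1 where e: "P = g P0" "P' = g P1" "P0 \<in> S" "P1 \<in> S" by auto
    show "\<bar>fst P' - fst P\<bar> \<le> 6 * \<rho>"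
      using S(1)[OF e(3)] S(1)[OF e(4)] unfolding e g_def fst_conv by linarith
    have "snd P' - snd P = (snd P1 - f x - h x * (fst P1 - x)) - (snd P0 - f x - h x * (fst P0 - x))"
      unfolding e g_def by (simp add: algebra_simps)
    then show "\<bar>snd P' - snd P\<bar> \<le> 2 * (C * \<rho>\<^sup>2)"
      using S(2)[OF e(3)] S(2)[OF e(4)] by linarith
    assume "P \<noteq> P'"
    then have "P0 \<noteq> P1" using e by auto
    then show "1 \<le> c * Q ^ 3 * \<rho>\<^sup>2 * \<bar>fst P' - fst P\<bar> + c * Q ^ 3 * \<rho> * \<bar>snd P' - snd P\<bar>"
      using generic_separated[OF assms(1,2,4,5) c_def _ S(1)[OF e(3)] S(2)[OF e(3)], of P1] assms(7) e(3,4)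
      unfolding e(1,2) g_def fst_conv snd_conv by blast
  next
    show "0 < 1 / (8 * Q ^ 3)" using assms(1) by simp
  qed (use assms(1,2,5,6) in \<open>auto simp: c_def\<close>)
  also have "\<dots> = 1 + (arc_const C - 1) * (Q * \<rho>) ^ 3"
    unfolding arc_const_def c_def by (simp add: power3_eq_cube power2_eq_square algebra_simps)
  also have "\<dots> \<le> arc_const C * (Q * \<rho>) ^ 3"
    using one_le_power[OF assms(3), of 3] by (simp add: algebra_simps)
  finally show ?thesis using inj by (simp add: card_image)
qed

section \<open>Covering the points close to rational points, along the whole arc\<close>

definition curve_const :: real
  where "curve_const = (\<beta> - \<alpha> + 1) * arc_const (2 + c2 / 2 + 2 * M)"

lemma arc_const_nonneg: "C \<ge> 0 \<Longrightarrow> arc_const C \<ge> 0"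
  unfolding arc_const_def by (intro add_nonneg_nonneg mult_nonneg_nonneg) auto

lemma M_nonneg: "0 \<le> M" using slope[of \<alpha>] le by auto

text \<open>About \<open>1 / \<rho>\<close> short arcs carry O(\<open>(Q * \<rho>) ^ 3\<close>)
  rational points each. \<open>T P\<close> leaves room for the sharper condition on one of the two
  coordinates.\<close>

lemma covered_near_rational_points:
  assumes "1 \<le> Q" "0 < \<rho>" "\<rho> \<le> 1" "1 \<le> Q * \<rho>" "0 \<le> m" "\<And>P. covered (T P) m"
  shows "covered {x \<in> {\<alpha>..\<beta>}. generic Q \<rho> x \<and>
      (\<exists>P\<in>rational_points Q. \<bar>x - fst P\<bar> \<le> 2 * \<rho>\<^sup>2 \<and> \<bar>f x - snd P\<bar> \<le> 2 * \<rho>\<^sup>2 \<and> x \<in> T P)}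
    (curve_const * (Q ^ 3 * \<rho>\<^sup>2) * m)"
proof -
  \<comment> \<open>The summands bound the distance of \<open>snd P\<close> from \<open>f x\<close>,
    the Taylor remainder between \<open>x0\<close> and \<open>x\<close>, and the slope times the
    distance of \<open>x\<close> from \<open>fst P\<close>.\<close>
  let ?C = "2 + c2 / 2 + 2 * M"
  let ?K = "arc_const ?C"
  let ?S = "{x \<in> {\<alpha>..\<beta>}. generic Q \<rho> x \<and>
      (\<exists>P\<in>rational_points Q. \<bar>x - fst P\<bar> \<le> 2 * \<rho>\<^sup>2 \<and> \<bar>f x - snd P\<bar> \<le> 2 * \<rho>\<^sup>2 \<and> x \<in> T P)}"
  have C0: "0 \<le> ?C" using M_nonneg c1 c12 by auto
  have K0: "0 \<le> ?K" by (rule arc_const_nonneg[OF C0])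
  have "covered ?S (((\<beta> - \<alpha>) / \<rho> + 1) * (?K * (Q * \<rho>) ^ 3 * m))"
  proof (rule covered_grid)
    fix u
    show "covered (?S \<inter> {u..u + \<rho>}) (?K * (Q * \<rho>) ^ 3 * m)"
    proof (cases "?S \<inter> {u..u + \<rho>} = {}")
      case True
      then show ?thesis using covered_mono[OF covered_empty] K0 assms by simp
    next
      case False
      \<comment> \<open>One generic point per short arc suffices, since the count is made relative
        to it.\<close>
      then obtain x0 where x0: "x0 \<in> ?S" "x0 \<in> {u..u + \<rho>}" by blast
      define R where "R = {P \<in> rational_points Q.
        \<exists>x \<in> ?S \<inter> {u..u + \<rho>}. \<bar>x - fst P\<bar> \<le> 2 * \<rho>\<^sup>2 \<and> \<bar>f x - snd P\<bar> \<le> 2 * \<rho>\<^sup>2}"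
      have near: "\<bar>fst P - x0\<bar> \<le> 3 * \<rho> \<and> \<bar>snd P - f x0 - h x0 * (fst P - x0)\<bar> \<le> ?C * \<rho>\<^sup>2" if "P \<in> R" for P
      proof -
        obtain x where x: "x \<in> {\<alpha>..\<beta>}" "x \<in> {u..u + \<rho>}" "\<bar>x - fst P\<bar> \<le> 2 * \<rho>\<^sup>2" "\<bar>f x - snd P\<bar> \<le> 2 * \<rho>\<^sup>2"
          using \<open>P \<in> R\<close> unfolding R_def by blast
        have r: "\<rho>\<^sup>2 \<le> \<rho>" using assms by (simp add: power2_eq_square mult_left_le)
        have xx: "\<bar>x - x0\<bar> \<le> \<rho>" using x(2) x0(2) by auto
        then have sq: "(x - x0)\<^sup>2 \<le> \<rho>\<^sup>2" by (simp add: abs_le_square_iff[symmetric] assms(2))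
        have "h x0 * (x - x0) + c1 / 2 * (x - x0)\<^sup>2 \<le> f x - f x0" "f x - f x0 \<le> h x0 * (x - x0) + c2 / 2 * (x - x0)\<^sup>2"
          using lower upper x0 x by blast+
        moreover have "0 \<le> c1 / 2 * (x - x0)\<^sup>2" using c1 by simp
        moreover have "c2 / 2 * (x - x0)\<^sup>2 \<le> c2 / 2 * \<rho>\<^sup>2"
          using sq c1 c12 by (intro mult_left_mono) auto
        ultimately have "\<bar>f x - f x0 - h x0 * (x - x0)\<bar> \<le> c2 / 2 * \<rho>\<^sup>2" by linarith
        moreover have "\<bar>h x0 * (x - fst P)\<bar> \<le> M * (2 * \<rho>\<^sup>2)"
          unfolding abs_mult using x(3) slope[of x0] x0 M_nonneg by (intro mult_mono) auto
        moreover have "snd P - f x0 - h x0 * (fst P - x0) = (snd P - f x) + (f x - f x0 - h x0 * (x - x0)) + h x0 * (x - fst P)"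
          by (simp add: algebra_simps)
        ultimately have "\<bar>snd P - f x0 - h x0 * (fst P - x0)\<bar> \<le> 2 * \<rho>\<^sup>2 + c2 / 2 * \<rho>\<^sup>2 + M * (2 * \<rho>\<^sup>2)"
          using x(4) by linarith
        moreover have "2 * \<rho>\<^sup>2 + c2 / 2 * \<rho>\<^sup>2 + M * (2 * \<rho>\<^sup>2) = ?C * \<rho>\<^sup>2" by (simp add: algebra_simps)
        moreover have "\<bar>fst P - x0\<bar> \<le> 3 * \<rho>" using x(3) xx r by linarith
        ultimately show ?thesis by simp
      qed
      \<comment> \<open>Finiteness of \<open>R\<close> is not known beforehand, so its finite
        subsets are bounded first.\<close>
      have fin: "real (card F) \<le> ?K * (Q * \<rho>) ^ 3" if "finite F" "F \<subseteq> R" for F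
      proof (rule card_rational_points_le[of Q \<rho> x0])
        show "\<bar>fst P - x0\<bar> \<le> 3 * \<rho>" "\<bar>snd P - f x0 - h x0 * (fst P - x0)\<bar> \<le> ?C * \<rho>\<^sup>2" if "P \<in> F" for P
          using near[of P] \<open>F \<subseteq> R\<close> that by auto
        show "F \<subseteq> rational_points Q" using \<open>F \<subseteq> R\<close> unfolding R_def by blast
        show "generic Q \<rho> x0" using x0 by blast
      qed (use that assms C0 in auto)
      have "finite R \<and> card R \<le> nat \<lfloor>?K * (Q * \<rho>) ^ 3\<rfloor>"
        by (rule finite_if_finite_subsets_card_bdd) (use fin in \<open>auto simp: le_nat_floor\<close>)
      then have R: "finite R" "real (card R) \<le> ?K * (Q * \<rho>) ^ 3" using fin by auto
      have "covered (\<Union>P\<in>R. T P) (?K * (Q * \<rho>) ^ 3 * m)"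
        using R assms by (intro covered_UN) auto
      moreover have "?S \<inter> {u..u + \<rho>} \<subseteq> (\<Union>P\<in>R. T P)"
        unfolding R_def by blast
      ultimately show ?thesis using covered_mono by blast
    qed
  qed (use assms K0 le in auto)
  then show ?thesis
  proof (rule covered_mono)
    have "((\<beta> - \<alpha>) / \<rho> + 1) * (?K * (Q * \<rho>) ^ 3 * m) \<le> ((\<beta> - \<alpha> + 1) / \<rho>) * (?K * (Q * \<rho>) ^ 3 * m)"
      using assms K0 le by (intro mult_right_mono mult_nonneg_nonneg) (auto simp: field_simps)
    also have "\<dots> = curve_const * (Q ^ 3 * \<rho>\<^sup>2) * m"
      unfolding curve_const_def using assms(2) by (simp add: field_simps power3_eq_cube power2_eq_square)
    finally show "((\<beta> - \<alpha>) / \<rho> + 1) * (?K * (Q * \<rho>) ^ 3 * m) \<le> curve_const * (Q ^ 3 * \<rho>\<^sup>2) * m" .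
  qed simp
qed

subsection \<open>The exceptional set\<close>

text \<open>The function is strongly convex with constant \<open>c1 * A\<close>. On either side of
  its minimum, moving away from the nearer point raises it by at least \<open>c1 * A / 2\<close>
  times the squared distance, while it can vary by at most \<open>2 * \<epsilon>\<close>. The two
  sides give the factor 8.\<close>

lemma covered_level_set:
  fixes b0 b1 b2 :: real
  assumes "0 < A" "A \<le> b2" "0 \<le> \<epsilon>"
  shows "covered {x \<in> {\<alpha>..\<beta>}. \<bar>b0 + b1 * x + b2 * f x\<bar> \<le> \<epsilon>} (8 * sqrt (\<epsilon> / (c1 * A)))"
proof -
  let ?F = "\<lambda>x. b0 + b1 * x + b2 * f x"
  let ?d = "2 * sqrt (\<epsilon> / (c1 * A))"
  let ?S = "{x \<in> {\<alpha>..\<beta>}. \<bar>?F x\<bar> \<le> \<epsilon>}"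
  have main: "\<bar>x - y\<bar> \<le> ?d" if "x \<in> ?S" "y \<in> ?S" "0 \<le> (b1 + b2 * h x) * (y - x)" for x y
  proof -
    have "b2 * (h x * (y - x) + c1 / 2 * (y - x)\<^sup>2) \<le> b2 * (f y - f x)"
      using lower[of x y] that assms by (intro mult_left_mono) auto
    then have "(b1 + b2 * h x) * (y - x) + b2 * (c1 / 2 * (y - x)\<^sup>2) \<le> ?F y - ?F x"
      by (simp add: algebra_simps)
    moreover have "?F y - ?F x \<le> 2 * \<epsilon>" using that by auto
    moreover have "A * (c1 / 2 * (y - x)\<^sup>2) \<le> b2 * (c1 / 2 * (y - x)\<^sup>2)"
      using assms c1 by (intro mult_right_mono) auto
    ultimately have "A * (c1 / 2 * (y - x)\<^sup>2) \<le> 2 * \<epsilon>" using that(3) by linarith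
    then have "(y - x)\<^sup>2 \<le> 4 * (\<epsilon> / (c1 * A))" using assms c1 by (simp add: field_simps)
    then have "\<bar>y - x\<bar> \<le> sqrt (4 * (\<epsilon> / (c1 * A)))" by (metis real_sqrt_abs real_sqrt_le_mono)
    also have "\<dots> = ?d" by (simp only: real_sqrt_mult real_sqrt_four)
    finally show ?thesis by (simp only: abs_minus_commute)
  qed
  have sgn: "covered {x \<in> ?S. 0 \<le> \<sigma> * (b1 + b2 * h x)} (2 * ?d)" if "\<sigma> = 1 \<or> \<sigma> = -1" for \<sigma> :: real
  proof (rule covered_diameter)
    fix x y assume xy: "x \<in> {x \<in> ?S. 0 \<le> \<sigma> * (b1 + b2 * h x)}" "y \<in> {x \<in> ?S. 0 \<le> \<sigma> * (b1 + b2 * h x)}"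
    have \<sigma>: "(\<sigma> * v) * (\<sigma> * w) = v * w" for v w using that by auto
    have "\<sigma> * (x - y) = - (\<sigma> * (y - x))" by (simp add: algebra_simps)
    \<comment> \<open>The two cases decide from which of the two points the function grows towards
      the other.\<close>
    then consider "0 \<le> \<sigma> * (y - x)" | "0 \<le> \<sigma> * (x - y)" by linarith
    then show "\<bar>x - y\<bar> \<le> ?d"
    proof cases
      case 1
      then have "0 \<le> (b1 + b2 * h x) * (y - x)"
        using mult_nonneg_nonneg[of "\<sigma> * (b1 + b2 * h x)", OF _ 1] xy(1) unfolding \<sigma> by blast
      then show ?thesis using main[of x y] xy by blast
    next
      case 2
      then have "0 \<le> (b1 + b2 * h y) * (x - y)"
        using mult_nonneg_nonneg[of "\<sigma> * (b1 + b2 * h y)", OF _ 2] xy(2) unfolding \<sigma> by blast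
      then have "\<bar>y - x\<bar> \<le> ?d" using main[of y x] xy by blast
      then show ?thesis by (simp only: abs_minus_commute)
    qed
  qed (use assms c1 in auto)
  have "covered ({x \<in> ?S. 0 \<le> 1 * (b1 + b2 * h x)} \<union> {x \<in> ?S. 0 \<le> -1 * (b1 + b2 * h x)}) (2 * ?d + 2 * ?d)"
    by (intro covered_Un sgn) (use assms c1 in auto)
  then show ?thesis
  proof (rule covered_mono)
    have sgn_cases: "0 \<le> 1 * v \<or> 0 \<le> -1 * v" for v :: real by linarith
    show "?S \<subseteq> {x \<in> ?S. 0 \<le> 1 * (b1 + b2 * h x)} \<union> {x \<in> ?S. 0 \<le> -1 * (b1 + b2 * h x)}"
      using sgn_cases by blast
  qed simp
qed

text \<open>Here \<open>l = Q^(1/36)\<close>, which makes all exponents integral.\<close>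
definition exceptional :: "real \<Rightarrow> real \<Rightarrow> real set"
  where "exceptional l A = {x \<in> {\<alpha>..\<beta>}. \<exists>a0 a1 a2 :: int. A \<le> of_int a2 \<and> of_int a2 \<le> 2 * A \<and>
    \<bar>of_int a0 + of_int a1 * x + of_int a2 * f x\<bar> \<le> 1 / l ^ 36 \<and> \<bar>of_int a1 + of_int a2 * h x\<bar> \<le> 1 / l ^ 8}"

text \<open>Taylor expansion at \<open>x\<close> of the function with coefficients
  \<open>b0\<close>, \<open>b1\<close>, \<open>b2\<close>, whose slope at \<open>x\<close> is
  \<open>b1 + b2 * h x\<close>.\<close>

lemma transfer_along_arc:
  assumes "x \<in> {\<alpha>..\<beta>}" "y \<in> {\<alpha>..\<beta>}" "\<bar>y - x\<bar> \<le> r" "0 \<le> b2" "b2 \<le> 2 * A"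
    and "\<bar>b0 + b1 * x + b2 * f x\<bar> \<le> \<epsilon>" "\<bar>b1 + b2 * h x\<bar> \<le> \<epsilon>'"
  shows "\<bar>b0 + b1 * y + b2 * f y\<bar> \<le> \<epsilon> + \<epsilon>' * r + c2 * A * r\<^sup>2"
    and "\<bar>b1 + b2 * h y\<bar> \<le> \<epsilon>' + 2 * A * c2 * r"
proof -
  have r: "0 \<le> r" using assms(3) by linarith
  have sq: "(y - x)\<^sup>2 \<le> r\<^sup>2" using assms(3) r by (simp add: abs_le_square_iff[symmetric])
  have "b0 + b1 * y + b2 * f y = (b0 + b1 * x + b2 * f x) + (b1 + b2 * h x) * (y - x) + b2 * (f y - f x - h x * (y - x))"
    by (simp add: algebra_simps)
  moreover have "\<bar>(b1 + b2 * h x) * (y - x)\<bar> \<le> \<epsilon>' * r"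
    unfolding abs_mult using assms by (intro mult_mono) auto
  moreover have "2 * A * (c2 / 2 * r\<^sup>2) = c2 * A * r\<^sup>2" by simp
  moreover have "\<bar>b2 * (f y - f x - h x * (y - x))\<bar> \<le> (2 * A) * (c2 / 2 * r\<^sup>2)"
    unfolding abs_mult
  proof (rule mult_mono)
    have "c2 / 2 * (y - x)\<^sup>2 \<le> c2 / 2 * r\<^sup>2" using sq c1 c12 by (intro mult_left_mono) auto
    then show "\<bar>f y - f x - h x * (y - x)\<bar> \<le> c2 / 2 * r\<^sup>2" using taylor[OF assms(1,2)] by linarith
  qed (use assms in auto)
  ultimately show "\<bar>b0 + b1 * y + b2 * f y\<bar> \<le> \<epsilon> + \<epsilon>' * r + c2 * A * r\<^sup>2"
    using assms(6) \<open>2 * A * (c2 / 2 * r\<^sup>2) = c2 * A * r\<^sup>2\<close> by linarith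
  have "\<bar>b2 * (h y - h x)\<bar> \<le> (2 * A) * (c2 * r)"
    unfolding abs_mult
  proof (rule mult_mono)
    have "c2 * \<bar>y - x\<bar> \<le> c2 * r" using assms(3) c1 c12 by (intro mult_left_mono) auto
    then show "\<bar>h y - h x\<bar> \<le> c2 * r" using slope_lipschitz[OF assms(1,2)] by linarith
  qed (use assms in auto)
  moreover have "b1 + b2 * h y = (b1 + b2 * h x) + b2 * (h y - h x)" by (simp add: algebra_simps)
  ultimately show "\<bar>b1 + b2 * h y\<bar> \<le> \<epsilon>' + 2 * A * c2 * r" using assms(7) by linarith
qed

text \<open>Otherwise the cross product \<open>(q, p, _)\<close> of the two vectors would contradict the assumption
  that \<open>x\<close> is not close to any \<open>p / q\<close>.\<close>
lemma dual_points_parallel: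
  fixes a0 a1 a2 a0' a1' a2' :: int
  assumes A: "0 < A" "A \<le> of_int a2" "of_int a2 \<le> 2 * A" "A \<le> of_int a2'" "of_int a2' \<le> 2 * A"
    and "\<bar>of_int a0 + of_int a1 * x + of_int a2 * f x\<bar> \<le> \<phi>" "\<bar>of_int a1 + of_int a2 * h x\<bar> \<le> \<phi>'"
    and "\<bar>of_int a0' + of_int a1' * x + of_int a2' * f x\<bar> \<le> \<phi>" "\<bar>of_int a1' + of_int a2' * h x\<bar> \<le> \<phi>'"
    and small: "4 * A * \<phi> < 1"
    and far: "\<not> (\<exists>q p :: int. 1 \<le> q \<and> of_int q \<le> 4 * A * \<phi>' \<and> \<bar>of_int q * x - of_int p\<bar> \<le> 4 * A * \<phi>)"
  shows "a2 * a1' = a1 * a2' \<and> a2 * a0' = a0 * a2'"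
proof -
  define v0 where "v0 = a1 * a2' - a2 * a1'"
  define v1 where "v1 = a2 * a0' - a0 * a2'"
  have e0: "of_int v0 = of_int a2' * (of_int a1 + of_int a2 * h x) - of_int a2 * (of_int a1' + of_int a2' * h x)"
    unfolding v0_def by (simp add: algebra_simps)
  have e1: "of_int v1 - of_int v0 * x = of_int a2 * (of_int a0' + of_int a1' * x + of_int a2' * f x)
      - of_int a2' * (of_int a0 + of_int a1 * x + of_int a2 * f x)"
    unfolding v0_def v1_def by (simp add: algebra_simps)
  have m: "\<bar>b * z\<bar> \<le> (2 * A) * w" if "A \<le> b" "b \<le> 2 * A" "\<bar>z\<bar> \<le> w" for b z w :: real
    unfolding abs_mult using that A(1) by (intro mult_mono) auto
  have b0: "\<bar>of_int v0\<bar> \<le> 4 * A * \<phi>'"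
    using m[OF A(4,5) assms(7)] m[OF A(2,3) assms(9)] unfolding e0 by linarith
  have b1: "\<bar>of_int v1 - of_int v0 * x\<bar> \<le> 4 * A * \<phi>"
    using m[OF A(4,5) assms(6)] m[OF A(2,3) assms(8)] unfolding e1 by linarith
  have "v0 = 0"
  proof (rule ccontr)
    assume "v0 \<noteq> 0"
    then have "1 \<le> \<bar>v0\<bar>" by linarith
    \<comment> \<open>Multiplying by the sign of \<open>v0\<close> makes the denominator positive,
      as \<open>far\<close> demands.\<close>
    moreover have "\<bar>of_int \<bar>v0\<bar> * x - of_int (sgn v0 * v1)\<bar> = \<bar>of_int v1 - of_int v0 * x\<bar>"
      by (cases "v0 > 0") (use \<open>v0 \<noteq> 0\<close> in \<open>auto simp: abs_minus_commute\<close>)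
    ultimately show False using far b0 b1 by (metis of_int_abs)
  qed
  moreover from this have "\<bar>of_int v1 :: real\<bar> < 1" using b1 small by simp
  then have "v1 = 0" by linarith
  ultimately show ?thesis unfolding v0_def v1_def by simp
qed

text \<open>The first summand pays for the neighbourhoods of rationals, the second for the level
  sets on the remaining short arcs.\<close>

definition dyadic_const :: real
  where "dyadic_const = 64 * (\<beta> - \<alpha> + 3) * (1 + 2 * c2) * (2 + c2) + (\<beta> - \<alpha> + 1) * (8 * sqrt (2 / c1))"

text \<open>Off the set \<open>?Z\<close> of points near rationals with small denominator, all
  integer vectors occurring in an arc of length \<open>r\<close> are parallel, so one of them
  confines that part of the exceptional set to a level set.\<close>

lemma covered_exceptional:
  assumes l: "1 \<le> l" "4 * (2 + c2) < l" and A: "1 \<le> A" "A \<le> l ^ 20"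
  shows "covered (exceptional l A) (dyadic_const / l)"
proof -
  define s where "s = sqrt A"
  \<comment> \<open>This length balances the two costs. With it \<open>A * \<phi>\<close> and
    \<open>A * \<phi>'\<close> are O(\<open>1 / l ^ 14\<close>) and O(\<open>l ^ 13\<close>), so
    \<open>?Z\<close> costs O(\<open>1 / l\<close>); the level sets cost
    O(\<open>1 / (l ^ 18 * s)\<close>) on each of O(\<open>1 / r\<close>) arcs, again
    O(\<open>1 / l\<close>).\<close>
  define r where "r = 1 / (l ^ 17 * s)"
  have s: "1 \<le> s" "A = s\<^sup>2" "s \<le> l ^ 10"
  proof -
    show "1 \<le> s" "A = s\<^sup>2" using A unfolding s_def by auto
    have "s\<^sup>2 \<le> (l ^ 10)\<^sup>2" using A \<open>A = s\<^sup>2\<close> by (simp add: power_mult[symmetric])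
    then show "s \<le> l ^ 10" by (rule power2_le_imp_le) (use l in simp)
  qed
  have r0: "0 < r" unfolding r_def using s l by auto
  have r1: "r \<le> 1" unfolding r_def using s l by (simp add: mult_ge1_I)
  \<comment> \<open>The bounds of \<open>transfer_along_arc\<close> for displacement
    \<open>r\<close> and the thresholds of \<open>exceptional\<close>.\<close>
  define \<phi> where "\<phi> = 1 / l ^ 36 + 1 / l ^ 8 * r + c2 * A * r\<^sup>2"
  define \<phi>' where "\<phi>' = 1 / l ^ 8 + 2 * A * c2 * r"
  have l0: "0 < l" using l by simp
  have "s * r = 1 / l ^ 17" unfolding r_def using s(1) by simp
  moreover have "A * r = s * (s * r)" "A * r\<^sup>2 = (s * r)\<^sup>2"
    unfolding s(2) by (simp_all add: power2_eq_square)
  ultimately have Ar: "A * r = s / l ^ 17" "A * r\<^sup>2 = 1 / l ^ 34"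
    by (simp_all add: power_divide power_mult[symmetric])
  have A\<phi>: "A * \<phi> \<le> (2 + c2) / l ^ 14"
  proof -
    have "A * \<phi> = A / l ^ 36 + (A * r) / l ^ 8 + c2 * A * (A * r\<^sup>2)"
      unfolding \<phi>_def by (simp add: algebra_simps)
    also have "\<dots> = A / l ^ 36 + s / l ^ 25 + c2 * A / l ^ 34"
      unfolding Ar by (simp add: power_add[symmetric])
    also have "A / l ^ 36 \<le> l ^ 20 / l ^ 36" using A l by (intro divide_right_mono) auto
    also have "l ^ 20 / l ^ 36 = 1 / l ^ 16" using l0 by (simp add: field_simps power_add[symmetric])
    also have "1 / l ^ 16 \<le> 1 / l ^ 14" using l by (intro divide_left_mono power_increasing) auto
    also have "s / l ^ 25 \<le> l ^ 10 / l ^ 25" using s l by (intro divide_right_mono) auto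
    also have "l ^ 10 / l ^ 25 = 1 / l ^ 15" using l0 by (simp add: field_simps power_add[symmetric])
    also have "1 / l ^ 15 \<le> 1 / l ^ 14" using l by (intro divide_left_mono power_increasing) auto
    also have "c2 * A / l ^ 34 \<le> c2 * l ^ 20 / l ^ 34"
      using A l c1 c12 by (intro divide_right_mono mult_left_mono) auto
    also have "c2 * l ^ 20 / l ^ 34 = c2 / l ^ 14" using l0 by (simp add: field_simps power_add[symmetric])
    finally show ?thesis by (simp add: add_divide_distrib)
  qed
  have A\<phi>': "A * \<phi>' \<le> (1 + 2 * c2) * l ^ 13"
  proof -
    have "A * \<phi>' = A / l ^ 8 + 2 * c2 * A * (A * r)"
      unfolding \<phi>'_def by (simp add: algebra_simps)
    also have "\<dots> = A / l ^ 8 + 2 * c2 * (A * s) / l ^ 17"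
      unfolding Ar by simp
    also have "A / l ^ 8 \<le> l ^ 20 / l ^ 8" using A l by (intro divide_right_mono) auto
    also have "l ^ 20 / l ^ 8 = l ^ 12" using l0 by (simp add: field_simps power_add[symmetric])
    also have "l ^ 12 \<le> l ^ 13" using l by (intro power_increasing) auto
    also have "2 * c2 * (A * s) / l ^ 17 \<le> 2 * c2 * (l ^ 20 * l ^ 10) / l ^ 17"
      using A s l c1 c12 by (intro divide_right_mono mult_left_mono mult_mono) auto
    also have "2 * c2 * (l ^ 20 * l ^ 10) / l ^ 17 = 2 * c2 * l ^ 13"
      using l0 by (simp add: field_simps power_add[symmetric])
    finally show ?thesis by (simp add: distrib_right)
  qed
  have \<phi>0: "0 \<le> \<phi>" "0 \<le> \<phi>'" unfolding \<phi>_def \<phi>'_def using l A r0 c1 c12 by auto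
  have small: "4 * A * \<phi> < 1"
  proof -
    have "l \<le> l ^ 14" using power_increasing[of 1 14 l] l(1) by simp
    then have "4 * (2 + c2) < l ^ 14" using l(2) by linarith
    then have "4 * ((2 + c2) / l ^ 14) < 1" using l0 by simp
    then show ?thesis using A\<phi> by linarith
  qed
  let ?Z = "{y \<in> {\<alpha>..\<beta>}. \<exists>q p :: int. 1 \<le> q \<and> of_int q \<le> 4 * A * \<phi>' \<and> \<bar>of_int q * y - of_int p\<bar> \<le> 4 * A * \<phi>}"
  have Z: "covered ?Z (64 * (\<beta> - \<alpha> + 3) * (1 + 2 * c2) * (2 + c2) / l)"
  proof (rule covered_mono)
    show "covered ?Z (4 * A * \<phi>' * (4 * (\<beta> - \<alpha> + 3) * (4 * A * \<phi>)))"
      using le \<phi>0 A(1) small by (intro covered_near_rationals mult_nonneg_nonneg) linarith+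
  next
    have "4 * A * \<phi>' * (4 * (\<beta> - \<alpha> + 3) * (4 * A * \<phi>)) = 64 * (\<beta> - \<alpha> + 3) * ((A * \<phi>') * (A * \<phi>))"
      by simp
    also have "\<dots> \<le> 64 * (\<beta> - \<alpha> + 3) * (((1 + 2 * c2) * l ^ 13) * ((2 + c2) / l ^ 14))"
      using \<phi>0 A(1) le l0 c1 c12 by (intro mult_left_mono mult_mono[OF A\<phi>' A\<phi>]) auto
    also have "\<dots> = 64 * (\<beta> - \<alpha> + 3) * (1 + 2 * c2) * (2 + c2) * (l ^ 13 / l ^ 14)"
      by (simp only: times_divide_eq_right times_divide_eq_left mult_ac)
    also have "l ^ 13 / l ^ 14 = 1 / l" using l0 power_add[of l 13 1] by simp
    finally show "4 * A * \<phi>' * (4 * (\<beta> - \<alpha> + 3) * (4 * A * \<phi>)) \<le> 64 * (\<beta> - \<alpha> + 3) * (1 + 2 * c2) * (2 + c2) / l" by simp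
  qed simp
  define m where "m = 8 * sqrt ((2 / l ^ 36) / (c1 * A))"
  have m0: "0 \<le> m" unfolding m_def using A l0 c1 by auto
  have m: "m = 8 * sqrt (2 / c1) / (l ^ 18 * s)"
  proof -
    have "(2 / l ^ 36) / (c1 * A) = (2 / c1) / (l ^ 18 * s)\<^sup>2"
      unfolding s(2) by (simp add: power_mult_distrib power_mult[symmetric])
    then have "sqrt ((2 / l ^ 36) / (c1 * A)) = sqrt (2 / c1) / \<bar>l ^ 18 * s\<bar>"
      by (simp only: real_sqrt_divide real_sqrt_abs)
    moreover have "\<bar>l ^ 18 * s\<bar> = l ^ 18 * s" using s(1) l0 by simp
    ultimately show ?thesis unfolding m_def by simp
  qed
  have "covered (exceptional l A - ?Z) (((\<beta> - \<alpha>) / r + 1) * m)"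
  proof (rule covered_grid)
    fix u
    show "covered ((exceptional l A - ?Z) \<inter> {u..u + r}) m"
    proof (cases "(exceptional l A - ?Z) \<inter> {u..u + r} = {}")
      case True
      then show ?thesis using covered_mono[OF covered_empty] m0 by simp
    next
      case False
      then obtain x where x: "x \<in> exceptional l A" "x \<notin> ?Z" "x \<in> {u..u + r}" by blast
      then obtain a0 a1 a2 :: int where a: "A \<le> of_int a2" "of_int a2 \<le> 2 * A"
          "\<bar>of_int a0 + of_int a1 * x + of_int a2 * f x\<bar> \<le> 1 / l ^ 36" "\<bar>of_int a1 + of_int a2 * h x\<bar> \<le> 1 / l ^ 8"
        and xJ: "x \<in> {\<alpha>..\<beta>}"
        unfolding exceptional_def by blast
      have "(exceptional l A - ?Z) \<inter> {u..u + r} \<subseteq>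
          {y \<in> {\<alpha>..\<beta>}. \<bar>of_int a0 + of_int a1 * y + of_int a2 * f y\<bar> \<le> 2 / l ^ 36}"
      proof
        fix y assume y: "y \<in> (exceptional l A - ?Z) \<inter> {u..u + r}"
        then obtain a0' a1' a2' :: int where a': "A \<le> of_int a2'" "of_int a2' \<le> 2 * A"
            "\<bar>of_int a0' + of_int a1' * y + of_int a2' * f y\<bar> \<le> 1 / l ^ 36" "\<bar>of_int a1' + of_int a2' * h y\<bar> \<le> 1 / l ^ 8"
          and yJ: "y \<in> {\<alpha>..\<beta>}"
          unfolding exceptional_def by blast
        have yx: "\<bar>x - y\<bar> \<le> r" using x(3) y by auto
        have "a2 * a1' = a1 * a2' \<and> a2 * a0' = a0 * a2'"
        proof (rule dual_points_parallel[where \<phi> = \<phi> and \<phi>' = \<phi>' and x = x])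
          show "\<bar>of_int a0' + of_int a1' * x + of_int a2' * f x\<bar> \<le> \<phi>" "\<bar>of_int a1' + of_int a2' * h x\<bar> \<le> \<phi>'"
            using transfer_along_arc[OF yJ xJ yx _ a'(2,3,4)] a'(1) A(1) unfolding \<phi>_def \<phi>'_def by auto
          show "\<bar>of_int a0 + of_int a1 * x + of_int a2 * f x\<bar> \<le> \<phi>" "\<bar>of_int a1 + of_int a2 * h x\<bar> \<le> \<phi>'"
            using transfer_along_arc[OF xJ xJ _ _ a(2,3,4), of r] a(1) A(1) r0 unfolding \<phi>_def \<phi>'_def by auto
          show "\<not> (\<exists>q p :: int. 1 \<le> q \<and> of_int q \<le> 4 * A * \<phi>' \<and> \<bar>of_int q * x - of_int p\<bar> \<le> 4 * A * \<phi>)"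
            using x(2) xJ by blast
        qed (use a(1,2) a'(1,2) A(1) small in simp_all)
        then have "real_of_int (a2 * a1') = of_int (a1 * a2')" "real_of_int (a2 * a0') = of_int (a0 * a2')" by simp_all
        then have "of_int a2' * (of_int a0 + of_int a1 * y + of_int a2 * f y) =
            of_int a2 * (of_int a0' + of_int a1' * y + of_int a2' * f y)"
          by (simp add: algebra_simps)
        then have "\<bar>of_int a2' * (of_int a0 + of_int a1 * y + of_int a2 * f y)\<bar> =
            \<bar>of_int a2 * (of_int a0' + of_int a1' * y + of_int a2' * f y)\<bar>" by (simp only:)
        moreover have "\<bar>of_int a2 :: real\<bar> = of_int a2" "\<bar>of_int a2' :: real\<bar> = of_int a2'"
          using a(1) a'(1) A(1) by simp_all
        ultimately have "of_int a2' * \<bar>of_int a0 + of_int a1 * y + of_int a2 * f y\<bar> =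
            of_int a2 * \<bar>of_int a0' + of_int a1' * y + of_int a2' * f y\<bar>"
          by (simp only: abs_mult)
        \<comment> \<open>Both third coefficients lie between \<open>A\<close> and
          \<open>2 * A\<close>, so passing to the fixed vector \<open>(a0, a1, a2)\<close> costs at
          most a factor 2.\<close>
        also have "\<dots> \<le> (2 * of_int a2') * (1 / l ^ 36)"
          using a(1,2) a'(1) A(1) by (intro mult_mono[OF _ a'(3)]) auto
        finally have "of_int a2' * \<bar>of_int a0 + of_int a1 * y + of_int a2 * f y\<bar> \<le> of_int a2' * (2 / l ^ 36)" by (simp add: mult_ac)
        then have "\<bar>of_int a0 + of_int a1 * y + of_int a2 * f y\<bar> \<le> 2 / l ^ 36"
          by (rule mult_left_le_imp_le) (use a'(1) A(1) in linarith)
        then show "y \<in> {y \<in> {\<alpha>..\<beta>}. \<bar>of_int a0 + of_int a1 * y + of_int a2 * f y\<bar> \<le> 2 / l ^ 36}"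
          using yJ by blast
      qed
      moreover have "covered {y \<in> {\<alpha>..\<beta>}. \<bar>of_int a0 + of_int a1 * y + of_int a2 * f y\<bar> \<le> 2 / l ^ 36} m"
        unfolding m_def using a A l0 by (intro covered_level_set) auto
      ultimately show ?thesis using covered_mono by blast
    qed
  qed (use r0 le m0 in \<open>auto simp: exceptional_def\<close>)
  then have "covered (exceptional l A - ?Z) ((\<beta> - \<alpha> + 1) * (8 * sqrt (2 / c1)) / l)"
  proof (rule covered_mono)
    have "((\<beta> - \<alpha>) / r + 1) * m \<le> ((\<beta> - \<alpha> + 1) / r) * m"
      using m0 r0 r1 by (intro mult_right_mono) (auto simp: field_simps)
    also have "\<dots> = (\<beta> - \<alpha> + 1) * (8 * sqrt (2 / c1)) * (l ^ 17 / l ^ 18)"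
      unfolding m r_def using s(1) l0 by (simp add: field_simps)
    also have "l ^ 17 / l ^ 18 = 1 / l" using l0 power_add[of l 17 1] by simp
    finally show "((\<beta> - \<alpha>) / r + 1) * m \<le> (\<beta> - \<alpha> + 1) * (8 * sqrt (2 / c1)) / l" by simp
  qed simp
  then have "covered (?Z \<union> (exceptional l A - ?Z))
     (64 * (\<beta> - \<alpha> + 3) * (1 + 2 * c2) * (2 + c2) / l + (\<beta> - \<alpha> + 1) * (8 * sqrt (2 / c1)) / l)"
    by (intro covered_Un Z) (use le l0 c1 c12 in auto)
  then show ?thesis
    by (rule covered_mono) (auto simp: dyadic_const_def add_divide_distrib)
qed

text \<open>A vector violating genericity at any admissible \<open>\<rho>\<close> has nonzero third
  coefficient of size at most \<open>l ^ 20\<close>. Up to sign it therefore belongs to one of at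
  most \<open>t + 1\<close> dyadic ranges, and the bound is uniform in
  \<open>\<rho>\<close>.\<close>

lemma covered_not_generic:
  assumes l: "1 < l" "4 * (2 + c2) < l" "l ^ 20 \<le> 2 ^ t"
  shows "covered {x \<in> {\<alpha>..\<beta>}. \<exists>\<rho>>0. 1 / l ^ 20 \<le> l ^ 36 * \<rho>\<^sup>2 \<and> \<not> generic (l ^ 36) \<rho> x}
    (real (t + 1) * (dyadic_const / l))"
proof -
  have l0: "0 < l" using l by simp
  have dc: "0 \<le> dyadic_const / l" unfolding dyadic_const_def using le c1 c12 l0
    by (intro divide_nonneg_pos add_nonneg_nonneg mult_nonneg_nonneg) auto
  let ?D = "{j \<in> {..t}. 2 ^ j \<le> l ^ 20}"
  have "covered (\<Union>j\<in>?D. exceptional l (2 ^ j)) (real (t + 1) * (dyadic_const / l))"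
  proof (rule covered_UN)
    show "covered (exceptional l (2 ^ j)) (dyadic_const / l)" if "j \<in> ?D" for j
      using that l by (intro covered_exceptional) auto
    have "card ?D \<le> card {..t}" by (intro card_mono) auto
    then show "real (card ?D) \<le> real (t + 1)" by simp
  qed (use dc in auto)
  then show ?thesis
  proof (rule covered_mono)
    show "{x \<in> {\<alpha>..\<beta>}. \<exists>\<rho>>0. 1 / l ^ 20 \<le> l ^ 36 * \<rho>\<^sup>2 \<and> \<not> generic (l ^ 36) \<rho> x}
      \<subseteq> (\<Union>j\<in>?D. exceptional l (2 ^ j))"
    proof
      fix x assume "x \<in> {x \<in> {\<alpha>..\<beta>}. \<exists>\<rho>>0. 1 / l ^ 20 \<le> l ^ 36 * \<rho>\<^sup>2 \<and> \<not> generic (l ^ 36) \<rho> x}"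
      then obtain \<rho> where \<rho>: "x \<in> {\<alpha>..\<beta>}" "\<rho> > 0" "1 / l ^ 20 \<le> l ^ 36 * \<rho>\<^sup>2" "\<not> generic (l ^ 36) \<rho> x" by auto
      then obtain b0 b1 b2 :: int where b: "\<bar>of_int b0 + of_int b1 * x + of_int b2 * f x\<bar> \<le> 1 / l ^ 36"
          "\<bar>of_int b1 + of_int b2 * h x\<bar> \<le> 1 / (l ^ 36 * \<rho>)" "\<bar>of_int b2\<bar> \<le> 1 / (l ^ 36 * \<rho>\<^sup>2)"
          "\<not> (b0 = 0 \<and> b1 = 0 \<and> b2 = 0)" unfolding generic_def by blast
      have "1 / (l ^ 36 * \<rho>\<^sup>2) \<le> 1 / (1 / l ^ 20)" using \<rho> l0 by (intro divide_left_mono) auto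
      then have b2: "\<bar>of_int b2\<bar> \<le> l ^ 20" using b(3) by simp
      \<comment> \<open>With \<open>Q = l ^ 36\<close>, the square of \<open>Q * \<rho>\<close> is
        \<open>Q\<close> times \<open>Q * \<rho> ^ 2\<close>, hence at least
        \<open>l ^ 16\<close>.\<close>
      have "l ^ 36 * (1 / l ^ 20) \<le> l ^ 36 * (l ^ 36 * \<rho>\<^sup>2)" using \<rho> l0 by (intro mult_left_mono) auto
      moreover have "l ^ 36 * (1 / l ^ 20) = (l ^ 8)\<^sup>2"
        using l0 by (simp add: field_simps power_add[symmetric] power_mult[symmetric])
      moreover have "l ^ 36 * (l ^ 36 * \<rho>\<^sup>2) = (l ^ 36 * \<rho>)\<^sup>2"
        by (simp only: power2_eq_square mult_ac)
      ultimately have "(l ^ 8)\<^sup>2 \<le> (l ^ 36 * \<rho>)\<^sup>2" by (simp only:)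
      then have "l ^ 8 \<le> l ^ 36 * \<rho>" by (rule power2_le_imp_le) (use \<rho>(2) l0 in simp)
      then have "1 / (l ^ 36 * \<rho>) \<le> 1 / l ^ 8" using l0 by (intro frac_le) auto
      then have b1: "\<bar>of_int b1 + of_int b2 * h x\<bar> \<le> 1 / l ^ 8" using b(2) by linarith
      \<comment> \<open>If \<open>b2\<close> vanished, then \<open>b1\<close> and after it
        \<open>b0\<close> would be integers of absolute value below 1.\<close>
      have nz: "b2 \<noteq> 0"
      proof
        assume "b2 = 0"
        have lt: "1 / l ^ k < 1" if "k > 0" for k using l(1) that by (simp add: one_less_power)
        have "\<bar>of_int b1 :: real\<bar> < 1" using b1 \<open>b2 = 0\<close> lt[of 8] by simp
        then have "b1 = 0" by linarith
        then have "\<bar>of_int b0 :: real\<bar> < 1" using b(1) \<open>b2 = 0\<close> lt[of 36] by simp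
        then have "b0 = 0" by linarith
        then show False using b(4) \<open>b1 = 0\<close> \<open>b2 = 0\<close> by simp
      qed
      define a0 a1 a2 where "a0 = sgn b2 * b0" and "a1 = sgn b2 * b1" and "a2 = \<bar>b2\<bar>"
      have a: "1 \<le> a2" "of_int a2 \<le> l ^ 20" "\<bar>of_int a0 + of_int a1 * x + of_int a2 * f x\<bar> \<le> 1 / l ^ 36"
          "\<bar>of_int a1 + of_int a2 * h x\<bar> \<le> 1 / l ^ 8"
      proof -
        show "1 \<le> a2" using nz unfolding a2_def by linarith
        show "of_int a2 \<le> l ^ 20" using b2 unfolding a2_def by simp
        have "of_int a0 + of_int a1 * x + of_int a2 * f x = of_int (sgn b2) * (of_int b0 + of_int b1 * x + of_int b2 * f x)"
          "of_int a1 + of_int a2 * h x = of_int (sgn b2) * (of_int b1 + of_int b2 * h x)"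
          using nz unfolding a0_def a1_def a2_def
          by (cases "b2 > 0"; simp add: distrib_left)+
        moreover have "\<bar>of_int (sgn b2) :: real\<bar> = 1" using nz by (auto simp: sgn_if)
        ultimately show "\<bar>of_int a0 + of_int a1 * x + of_int a2 * f x\<bar> \<le> 1 / l ^ 36"
          "\<bar>of_int a1 + of_int a2 * h x\<bar> \<le> 1 / l ^ 8" using b(1) b1 by (simp_all add: abs_mult)
      qed
      define n where "n = nat a2"
      have n: "n > 0" "of_int a2 = real n" using a(1) unfolding n_def by auto
      obtain j where j: "2 ^ j \<le> n" "n < 2 ^ (j + 1)"
        using ex_power_ivl1[of 2 n] n(1) by auto
      have j': "2 ^ j \<le> real n" "real n \<le> 2 * 2 ^ j"
        using of_nat_mono[OF j(1), where 'a = real] of_nat_mono[OF less_imp_le[OF j(2)], where 'a = real] by simp_all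
      have "2 ^ j \<le> l ^ 20" using j' a(2) n(2) by linarith
      then have "(2::real) ^ j \<le> 2 ^ t" using l(3) by linarith
      then have "j \<in> ?D" using \<open>2 ^ j \<le> l ^ 20\<close> by simp
      moreover have "x \<in> exceptional l (2 ^ j)"
      proof -
        have "2 ^ j \<le> (of_int a2 :: real)" "of_int a2 \<le> 2 * (2 ^ j :: real)" using j' n(2) by simp_all
        then show ?thesis unfolding exceptional_def using \<rho>(1) a(3,4) by blast
      qed
      ultimately show "x \<in> (\<Union>j\<in>?D. exceptional l (2 ^ j))" by blast
    qed
  qed simp
qed

subsection \<open>The limsup set\<close>

text \<open>With \<open>\<delta> = 1 / 2 ^ k\<close>, each rational point costs
  O(\<open>\<eta>\<close>), where the coordinate \<open>f x\<close> is handled by the expansion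
  constant \<open>c3\<close>. The total is a multiple of
  \<open>Q ^ 3 * \<rho> ^ 2 * \<eta> = 2 * Q * \<Psi>\<close>, which is independent of
  \<open>k\<close>.\<close>

lemma covered_dyadic_level:
  fixes t k :: nat and \<Psi> :: real
  assumes c3: "0 < c3" "\<And>x y. x \<in> {\<alpha>..\<beta>} \<Longrightarrow> y \<in> {\<alpha>..\<beta>} \<Longrightarrow> c3 * \<bar>x - y\<bar> \<le> \<bar>f x - f y\<bar>"
    and "k \<le> t" "0 < \<Psi>" "\<Psi> * 4 ^ k \<le> 1"
    and Q: "Q = 2 ^ t" and \<rho>: "\<rho> = sqrt (1 / (2 ^ k * 2 ^ t))" and \<eta>: "\<eta> = 2 * \<Psi> * 2 ^ k / 2 ^ t"
  shows "covered {x \<in> {\<alpha>..\<beta>}. generic Q \<rho> x \<and> (\<exists>P\<in>rational_points Q.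
      (\<bar>x - fst P\<bar> \<le> \<eta> \<and> \<bar>f x - snd P\<bar> \<le> \<rho>\<^sup>2) \<or> (\<bar>x - fst P\<bar> \<le> \<rho>\<^sup>2 \<and> \<bar>f x - snd P\<bar> \<le> \<eta>))}
    (8 * (1 + 1 / c3) * curve_const * (2 ^ t * \<Psi>))"
proof -
  let ?T = "\<lambda>P. {x \<in> {\<alpha>..\<beta>}. \<bar>x - fst P\<bar> \<le> \<eta>} \<union> {x \<in> {\<alpha>..\<beta>}. \<bar>f x - snd P\<bar> \<le> \<eta>}"
  have \<rho>0: "0 < \<rho>" unfolding \<rho> by simp
  have \<rho>2: "\<rho>\<^sup>2 = 1 / (2 ^ k * 2 ^ t)" unfolding \<rho> by simp
  have \<eta>0: "0 \<le> \<eta>" unfolding \<eta> using assms(4) by simp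
  \<comment> \<open>The cut-off \<open>\<Psi> * 4 ^ k \<le> 1\<close> makes the smaller tolerance
    \<open>\<eta>\<close> comparable to \<open>\<rho> ^ 2\<close> at worst.\<close>
  have "\<eta> = 2 * (\<Psi> * 4 ^ k) * \<rho>\<^sup>2"
    unfolding \<rho>2 \<eta> by (simp add: field_simps) (simp add: power_mult_distrib[symmetric] mult.assoc[symmetric])
  also have "\<dots> \<le> 2 * 1 * \<rho>\<^sup>2" using assms(5) by (intro mult_right_mono mult_left_mono) auto
  finally have \<eta>\<rho>: "\<eta> \<le> 2 * \<rho>\<^sup>2" by simp
  have "covered {x \<in> {\<alpha>..\<beta>}. generic Q \<rho> x \<and>
      (\<exists>P\<in>rational_points Q. \<bar>x - fst P\<bar> \<le> 2 * \<rho>\<^sup>2 \<and> \<bar>f x - snd P\<bar> \<le> 2 * \<rho>\<^sup>2 \<and> x \<in> ?T P)}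
    (curve_const * (Q ^ 3 * \<rho>\<^sup>2) * (4 * \<eta> * (1 + 1 / c3)))"
  proof (rule covered_near_rational_points)
    show "1 \<le> Q" unfolding Q by simp
    have "\<rho>\<^sup>2 \<le> 1\<^sup>2" unfolding \<rho>2 by (simp add: mult_ge1_I)
    then show "\<rho> \<le> 1" by (rule power2_le_imp_le) simp
    have "(1::real) \<le> 2 ^ t / 2 ^ k" using assms(3) by (simp add: power_increasing)
    also have "\<dots> = (Q * \<rho>)\<^sup>2" unfolding power_mult_distrib \<rho>2 Q by (simp add: power2_eq_square)
    finally have "1\<^sup>2 \<le> (Q * \<rho>)\<^sup>2" by simp
    then show "1 \<le> Q * \<rho>" by (rule power2_le_imp_le) (use \<rho>0 Q in simp)
    show "covered (?T P) (4 * \<eta> * (1 + 1 / c3))" for P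
    proof -
      have "covered {x \<in> {\<alpha>..\<beta>}. \<bar>x - fst P\<bar> \<le> \<eta>} (2 * (2 * \<eta>))"
        by (rule covered_diameter) (use \<eta>0 in auto)
      moreover have "covered {x \<in> {\<alpha>..\<beta>}. \<bar>f x - snd P\<bar> \<le> \<eta>} (2 * (2 * \<eta> / c3))"
      proof (rule covered_diameter)
        fix x y assume "x \<in> {x \<in> {\<alpha>..\<beta>}. \<bar>f x - snd P\<bar> \<le> \<eta>}" "y \<in> {x \<in> {\<alpha>..\<beta>}. \<bar>f x - snd P\<bar> \<le> \<eta>}"
        then have "c3 * \<bar>x - y\<bar> \<le> 2 * \<eta>" using c3(2)[of x y] by auto
        then show "\<bar>x - y\<bar> \<le> 2 * \<eta> / c3" using c3(1) by (simp add: field_simps)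
      qed (use \<eta>0 c3 in auto)
      ultimately have "covered (?T P) (2 * (2 * \<eta>) + 2 * (2 * \<eta> / c3))"
        by (rule covered_Un) (use \<eta>0 c3 in auto)
      then show ?thesis by (rule covered_mono) (auto simp: algebra_simps)
    qed
  qed (use \<rho>0 \<eta>0 c3 in auto)
  then show ?thesis
  proof (rule covered_mono)
    have "Q ^ 3 * \<rho>\<^sup>2 * \<eta> = 2 * (2 ^ t * \<Psi>)"
      unfolding \<rho>2 \<eta> Q by (simp add: power3_eq_cube)
    moreover have "curve_const * (Q ^ 3 * \<rho>\<^sup>2) * (4 * \<eta> * (1 + 1 / c3)) = 4 * curve_const * (1 + 1 / c3) * (Q ^ 3 * \<rho>\<^sup>2 * \<eta>)"
      by (simp only: mult_ac)
    moreover have "4 * C * X * (2 * Y) = 8 * X * C * Y" for C X Y :: real by simp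
    ultimately show "curve_const * (Q ^ 3 * \<rho>\<^sup>2) * (4 * \<eta> * (1 + 1 / c3)) \<le> 8 * (1 + 1 / c3) * curve_const * (2 ^ t * \<Psi>)"
      by (simp only: order_refl)
  next
    have r: "\<rho>\<^sup>2 \<le> 2 * \<rho>\<^sup>2" by simp
    have "\<bar>u\<bar> \<le> 2 * \<rho>\<^sup>2 \<and> \<bar>v\<bar> \<le> 2 * \<rho>\<^sup>2 \<and> (\<bar>u\<bar> \<le> \<eta> \<or> \<bar>v\<bar> \<le> \<eta>)"
      if "(\<bar>u\<bar> \<le> \<eta> \<and> \<bar>v\<bar> \<le> \<rho>\<^sup>2) \<or> (\<bar>u\<bar> \<le> \<rho>\<^sup>2 \<and> \<bar>v\<bar> \<le> \<eta>)" for u v :: real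
      using that r \<eta>\<rho> by linarith
    then show "{x \<in> {\<alpha>..\<beta>}. generic Q \<rho> x \<and> (\<exists>P\<in>rational_points Q.
        (\<bar>x - fst P\<bar> \<le> \<eta> \<and> \<bar>f x - snd P\<bar> \<le> \<rho>\<^sup>2) \<or> (\<bar>x - fst P\<bar> \<le> \<rho>\<^sup>2 \<and> \<bar>f x - snd P\<bar> \<le> \<eta>))}
      \<subseteq> {x \<in> {\<alpha>..\<beta>}. generic Q \<rho> x \<and> (\<exists>P\<in>rational_points Q.
        \<bar>x - fst P\<bar> \<le> 2 * \<rho>\<^sup>2 \<and> \<bar>f x - snd P\<bar> \<le> 2 * \<rho>\<^sup>2 \<and> x \<in> ?T P)}"
      by blast
  qed
qed

lemma curve_const_nonneg: "0 \<le> curve_const"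
  unfolding curve_const_def using le c1 c12 M_nonneg by (intro mult_nonneg_nonneg arc_const_nonneg) auto

text \<open>Non-generic points are paid for once for all levels; the generic ones are distributed
  over at most \<open>t + 1\<close> levels of equal cost.\<close>

lemma covered_dyadic_block:
  fixes t :: nat and l \<Psi> :: real
  assumes c3: "0 < c3" "\<And>x y. x \<in> {\<alpha>..\<beta>} \<Longrightarrow> y \<in> {\<alpha>..\<beta>} \<Longrightarrow> c3 * \<bar>x - y\<bar> \<le> \<bar>f x - f y\<bar>"
    and l: "1 < l" "4 * (2 + c2) < l" "l ^ 36 = 2 ^ t"
    and \<Psi>: "1 / l ^ 40 \<le> \<Psi>" "\<Psi> \<le> 1"
  shows "covered {x \<in> {\<alpha>..\<beta>}. \<exists>q::nat. 2 ^ t \<le> q \<and> q < 2 ^ Suc t \<and>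
      dist_nearest_int (real q * x) * dist_nearest_int (real q * f x) < \<Psi>}
    (real (t + 1) * (dyadic_const / l) + real (t + 1) * (8 * (1 + 1 / c3) * curve_const * (2 ^ t * \<Psi>)))"
proof -
  have l0: "0 < l" using l by simp
  then have \<Psi>0: "0 < \<Psi>" using \<Psi>(1) by (meson less_le_trans zero_less_divide_1_iff zero_less_power)
  have l20: "l ^ 20 \<le> 2 ^ t" unfolding l(3)[symmetric] using l by (intro power_increasing) auto
  define \<rho> where "\<rho> k = sqrt (1 / (2 ^ k * 2 ^ t))" for k :: nat
  define \<eta> where "\<eta> k = 2 * \<Psi> * 2 ^ k / 2 ^ t" for k :: nat
  let ?Q = "2 ^ t :: real"
  let ?B = "{x \<in> {\<alpha>..\<beta>}. \<exists>\<rho>>0. 1 / l ^ 20 \<le> l ^ 36 * \<rho>\<^sup>2 \<and> \<not> generic (l ^ 36) \<rho> x}"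
  let ?D = "{k \<in> {..t}. \<Psi> * 4 ^ k \<le> 1}"
  let ?E = "\<lambda>k. {x \<in> {\<alpha>..\<beta>}. generic ?Q (\<rho> k) x \<and> (\<exists>P\<in>rational_points ?Q.
      (\<bar>x - fst P\<bar> \<le> \<eta> k \<and> \<bar>f x - snd P\<bar> \<le> (\<rho> k)\<^sup>2) \<or> (\<bar>x - fst P\<bar> \<le> (\<rho> k)\<^sup>2 \<and> \<bar>f x - snd P\<bar> \<le> \<eta> k))}"
  let ?m = "8 * (1 + 1 / c3) * curve_const * (2 ^ t * \<Psi>)"
  have m0: "0 \<le> ?m" using c3 curve_const_nonneg \<Psi>0 by (intro mult_nonneg_nonneg) auto
  have dc: "0 \<le> dyadic_const / l" unfolding dyadic_const_def using le c1 c12 l0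
    by (intro divide_nonneg_pos add_nonneg_nonneg mult_nonneg_nonneg) auto
  have "covered (\<Union>k\<in>?D. ?E k) (real (t + 1) * ?m)"
  proof (rule covered_UN)
    show "covered (?E k) ?m" if "k \<in> ?D" for k
      by (rule covered_dyadic_level[OF c3 _ \<Psi>0]) (use that in \<open>auto simp: \<rho>_def \<eta>_def\<close>)
    have "card ?D \<le> card {..t}" by (intro card_mono) auto
    then show "real (card ?D) \<le> real (t + 1)" by simp
  qed (use m0 in auto)
  then have "covered (?B \<union> (\<Union>k\<in>?D. ?E k)) (real (t + 1) * (dyadic_const / l) + real (t + 1) * ?m)"
    by (rule covered_Un[OF covered_not_generic[OF l(1,2) l20]]) (rule mult_nonneg_nonneg, simp, fact)+
  then show ?thesis
  proof (rule covered_mono)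
    show "{x \<in> {\<alpha>..\<beta>}. \<exists>q::nat. 2 ^ t \<le> q \<and> q < 2 ^ Suc t \<and>
      dist_nearest_int (real q * x) * dist_nearest_int (real q * f x) < \<Psi>} \<subseteq> ?B \<union> (\<Union>k\<in>?D. ?E k)"
    proof
      fix x assume "x \<in> {x \<in> {\<alpha>..\<beta>}. \<exists>q::nat. 2 ^ t \<le> q \<and> q < 2 ^ Suc t \<and>
        dist_nearest_int (real q * x) * dist_nearest_int (real q * f x) < \<Psi>}"
      then obtain q :: nat where x: "x \<in> {\<alpha>..\<beta>}" and q: "2 ^ t \<le> q" "q < 2 ^ Suc t"
        and d: "dist_nearest_int (real q * x) * dist_nearest_int (real q * f x) < \<Psi>" by blast
      obtain p1 where p1: "dist_nearest_int (real q * x) = \<bar>real q * x - of_int p1\<bar>" "dist_nearest_int (real q * x) \<le> 1 / 2"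
        by (rule dist_nearest_int_attained)
      obtain p2 where p2: "dist_nearest_int (real q * f x) = \<bar>real q * f x - of_int p2\<bar>" "dist_nearest_int (real q * f x) \<le> 1 / 2"
        by (rule dist_nearest_int_attained)
      have rq: "?Q \<le> real q" "real q < 2 * ?Q"
      proof -
        have "real (2 ^ t) \<le> real q" "real q < real (2 ^ Suc t)"
          using q by (simp_all only: of_nat_le_iff of_nat_less_iff)
        then show "?Q \<le> real q" "real q < 2 * ?Q" by (simp_all only: of_nat_power of_nat_mult of_nat_numeral power_Suc)
      qed
      have q0: "0 < real q" using rq(1) by (meson less_le_trans zero_less_numeral zero_less_power)
      let ?P = "(of_int p1 / real q, of_int p2 / real q)"
      have P: "?P \<in> rational_points ?Q"
        unfolding rational_points_def mem_Collect_eq using rq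
        by (intro exI[of _ p1] exI[of _ p2] exI[of _ "int q"]) simp
      \<comment> \<open>Dividing by \<open>q \<ge> ?Q\<close> turns the tolerances
        \<open>1 / 2 ^ k\<close> and \<open>2 * \<Psi> * 2 ^ k\<close> into \<open>\<rho> k\<close>
        squared and \<open>\<eta> k\<close>.\<close>
      have div: "\<bar>z - of_int p / real q\<bar> \<le> e / ?Q" if "\<bar>real q * z - of_int p\<bar> \<le> e" for z e and p :: int
      proof -
        have "z - of_int p / real q = (real q * z - of_int p) / real q"
          using q0 by (simp add: diff_divide_distrib)
        then have "\<bar>z - of_int p / real q\<bar> = \<bar>real q * z - of_int p\<bar> / real q"
          by (simp only: abs_divide abs_of_nat)
        also have "\<dots> \<le> e / ?Q" using that rq(1) by (intro frac_le) auto
        finally show ?thesis .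
      qed
      let ?d1 = "dist_nearest_int (real q * x)" and ?d2 = "dist_nearest_int (real q * f x)"
      have "\<exists>k. \<Psi> * 4 ^ k \<le> 1 \<and> ((?d1 \<le> 2 * \<Psi> * 2 ^ k \<and> ?d2 \<le> 1 / 2 ^ k) \<or> (?d1 \<le> 1 / 2 ^ k \<and> ?d2 \<le> 2 * \<Psi> * 2 ^ k))"
      proof (cases "?d1 \<le> ?d2")
        case True
        obtain k where "\<Psi> * 4 ^ k \<le> 1" "?d2 \<le> 1 / 2 ^ k" "?d1 \<le> 2 * \<Psi> * 2 ^ k"
          by (rule dyadic_split[of ?d1 ?d2 \<Psi>]) (use True p1 p2 d \<Psi> \<Psi>0 in auto)
        then show ?thesis by blast
      next
        case False
        obtain k where "\<Psi> * 4 ^ k \<le> 1" "?d1 \<le> 1 / 2 ^ k" "?d2 \<le> 2 * \<Psi> * 2 ^ k"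
          by (rule dyadic_split[of ?d2 ?d1 \<Psi>]) (use False p1 p2 d \<Psi> \<Psi>0 in \<open>auto simp: mult.commute\<close>)
        then show ?thesis by blast
      qed
      then obtain k where k: "\<Psi> * 4 ^ k \<le> 1"
        and dk: "(?d1 \<le> 2 * \<Psi> * 2 ^ k \<and> ?d2 \<le> 1 / 2 ^ k) \<or> (?d1 \<le> 1 / 2 ^ k \<and> ?d2 \<le> 2 * \<Psi> * 2 ^ k)" by blast
      \<comment> \<open>The lower bound on \<open>\<Psi>\<close> limits \<open>2 ^ k\<close> to
        \<open>l ^ 20\<close>, exactly the range in which non-generic points are controlled.\<close>
      have "1 / l ^ 40 * 4 ^ k \<le> 1"
        using mult_right_mono[OF \<Psi>(1), of "4 ^ k"] k by simp
      then have "4 ^ k \<le> l ^ 40" using l0 by (simp add: field_simps)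
      then have "(2 ^ k)\<^sup>2 \<le> (l ^ 20)\<^sup>2"
        by (simp add: power2_eq_square[of "2 ^ k"] power_mult_distrib[symmetric])
      then have kl: "2 ^ k \<le> l ^ 20" by (rule power2_le_imp_le) (use l0 in simp)
      then have "(2::real) ^ k \<le> 2 ^ t" using l20 by linarith
      then have kD: "k \<in> ?D" using k by simp
      have \<rho>2: "(\<rho> k)\<^sup>2 = 1 / 2 ^ k / 2 ^ t" unfolding \<rho>_def by simp
      have "1 / l ^ 20 \<le> 1 / 2 ^ k" using kl by (intro frac_le) auto
      also have "1 / 2 ^ k = l ^ 36 * (\<rho> k)\<^sup>2" unfolding l(3) \<rho>2 by simp
      finally have low: "1 / l ^ 20 \<le> l ^ 36 * (\<rho> k)\<^sup>2" .
      have \<rho>0: "0 < \<rho> k" unfolding \<rho>_def by simp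
      show "x \<in> ?B \<union> (\<Union>k\<in>?D. ?E k)"
      proof (cases "generic ?Q (\<rho> k) x")
        case False
        then show ?thesis using x low \<rho>0 l(3) by auto
      next
        case True
        have "(\<bar>x - fst ?P\<bar> \<le> \<eta> k \<and> \<bar>f x - snd ?P\<bar> \<le> (\<rho> k)\<^sup>2) \<or>
            (\<bar>x - fst ?P\<bar> \<le> (\<rho> k)\<^sup>2 \<and> \<bar>f x - snd ?P\<bar> \<le> \<eta> k)"
          using dk unfolding \<rho>2 \<eta>_def fst_conv snd_conv p1(1) p2(1) by (blast intro: div)
        then have "x \<in> ?E k" using x True P by blast
        then show ?thesis using kD by blast
      qed
    qed
  qed simp
qed

text \<open>Borel-Cantelli over the blocks of \<open>q\<close> between consecutive powers of 2;
  since each block is finite, infinitely many \<open>q\<close> meet infinitely many blocks.\<close>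

lemma mult_approx_set_null:
  fixes \<psi> :: "nat \<Rightarrow> real"
  assumes c3: "0 < c3" "\<And>x y. x \<in> {\<alpha>..\<beta>} \<Longrightarrow> y \<in> {\<alpha>..\<beta>} \<Longrightarrow> c3 * \<bar>x - y\<bar> \<le> \<bar>f x - f y\<bar>"
    and pos: "\<And>q. 1 \<le> q \<Longrightarrow> 0 < \<psi> q" and mono: "antimono_on {1..} \<psi>"
    and sum: "summable (\<lambda>n. \<psi> (Suc n) * ln (real (Suc n)))"
  shows "mult_approx_set {\<alpha>..\<beta>} f \<psi> \<in> null_sets lebesgue"
proof -
  \<comment> \<open>Then \<open>l = b ^ t\<close> satisfies \<open>l ^ 36 = 2 ^ t\<close>.\<close>
  define b :: real where "b = 2 powr (1 / 36)"
  have b: "1 < b" "b ^ 36 = 2"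
    unfolding b_def by (simp_all add: powr_realpow[symmetric] powr_powr)
  \<comment> \<open>the added term keeps the dyadic levels in the range where the exceptional sets are small\<close>
  define \<Psi> where "\<Psi> t = \<psi> (2 ^ t) + 1 / (b ^ t) ^ 40" for t
  define S where "S t = {x \<in> {\<alpha>..\<beta>}. \<exists>q::nat. 2 ^ t \<le> q \<and> q < 2 ^ Suc t \<and>
      dist_nearest_int (real q * x) * dist_nearest_int (real q * f x) < \<Psi> t}" for t
  let ?K = "8 * (1 + 1 / c3) * curve_const"
  define m where "m t = real (t + 1) * (dyadic_const / b ^ t) + real (t + 1) * (?K * (2 ^ t * \<Psi> t))" for t
  have sum': "summable (\<lambda>t. real (t + 1) * 2 ^ t * \<psi> (2 ^ t))"
    by (rule summable_dyadic[OF pos mono sum])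
  have geo: "summable (\<lambda>t. real (t + 1) * (1 / b ^ t) ^ k)" if "k > 0" for k
  proof -
    have "norm ((1 / b) ^ k) < 1"
      using b(1) that by (simp add: power_less_one_iff power_divide one_less_power)
    then have "(\<lambda>n. of_nat (Suc n) * ((1 / b) ^ k) ^ n) sums (1 / (1 - (1 / b) ^ k)\<^sup>2)"
      by (rule geometric_deriv_sums)
    moreover have "((1 / b) ^ k) ^ n = (1 / b ^ n) ^ k" for n
      by (simp add: power_divide power_mult[symmetric] mult.commute)
    ultimately show ?thesis unfolding sums_iff by simp
  qed
  have m_eq: "m t = dyadic_const * (real (t + 1) * (1 / b ^ t) ^ 1) + ?K * (real (t + 1) * 2 ^ t * \<psi> (2 ^ t)) + ?K * (real (t + 1) * (1 / b ^ t) ^ 4)" for t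
  proof -
    have "(2::real) ^ t = (b ^ t) ^ 36" unfolding b(2)[symmetric] by (simp add: power_mult[symmetric] mult.commute)
    \<comment> \<open>Multiplied by the block length, the added term still decays geometrically, so
      it does not spoil summability.\<close>
    then have "2 ^ t * (1 / (b ^ t) ^ 40) = (1 / b ^ t) ^ 4"
      using b(1) by (simp add: power_divide field_simps power_add[symmetric])
    then have e: "2 ^ t * \<Psi> t = 2 ^ t * \<psi> (2 ^ t) + (1 / b ^ t) ^ 4" unfolding \<Psi>_def by (simp only: distrib_left)
    have "real (t + 1) * (dyadic_const / b ^ t) + real (t + 1) * (K * (2 ^ t * \<psi> (2 ^ t) + w)) =
        dyadic_const * (real (t + 1) * (1 / b ^ t) ^ 1) + K * (real (t + 1) * 2 ^ t * \<psi> (2 ^ t)) + K * (real (t + 1) * w)" for K w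
      by (simp add: algebra_simps)
    then show ?thesis unfolding m_def e .
  qed
  have "summable m"
    unfolding m_eq using geo[of 1] geo[of 4] sum' by (intro summable_add summable_mult) auto
  have "\<exists>n. 4 * (2 + c2) < b ^ n" using real_arch_pow[OF b(1)] by blast
  then obtain n1 where n1: "4 * (2 + c2) < b ^ n1" by blast
  \<comment> \<open>The terms of this series tend to 0, which gives the requirement
    \<open>\<Psi> t \<le> 1\<close> for large \<open>t\<close>.\<close>
  have "summable (\<lambda>t. real (t + 1) * 2 ^ t * \<psi> (2 ^ t) + real (t + 1) * (1 / b ^ t) ^ 4)"
    using sum' geo[of 4] by (intro summable_add) auto
  then have "(\<lambda>t. real (t + 1) * 2 ^ t * \<psi> (2 ^ t) + real (t + 1) * (1 / b ^ t) ^ 4) \<longlonglongrightarrow> 0"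
    by (rule summable_LIMSEQ_zero)
  then have "\<forall>\<^sub>F t in sequentially. real (t + 1) * 2 ^ t * \<psi> (2 ^ t) + real (t + 1) * (1 / b ^ t) ^ 4 < 1"
    by (rule order_tendstoD) simp
  then obtain n2 where n2: "\<And>t. t \<ge> n2 \<Longrightarrow> real (t + 1) * 2 ^ t * \<psi> (2 ^ t) + real (t + 1) * (1 / b ^ t) ^ 4 < 1"
    unfolding eventually_sequentially by blast
  have \<Psi>1: "\<Psi> t \<le> 1" if "t \<ge> n2" for t
  proof -
    have "1 * \<psi> (2 ^ t) \<le> (real (t + 1) * 2 ^ t) * \<psi> (2 ^ t)"
      using pos[of "2 ^ t"] by (intro mult_right_mono) (auto simp: mult_ge1_I)
    moreover have "(1 / b ^ t) ^ 40 \<le> (1 / b ^ t) ^ 4"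
      using b(1) by (intro power_decreasing) auto
    moreover have "1 * (1 / b ^ t) ^ 4 \<le> real (t + 1) * (1 / b ^ t) ^ 4"
      using b(1) by (intro mult_right_mono) auto
    ultimately show ?thesis using n2[OF that] unfolding \<Psi>_def by (simp add: power_divide)
  qed
  show ?thesis
  proof (rule covered_limsup_null[where S = S and m = m and N = "Suc (max n1 n2)"])
    fix t assume t: "t \<ge> Suc (max n1 n2)"
    then have tt: "t \<ge> n1" "t \<ge> n2" "t > 0" by auto
    have "b ^ n1 \<le> b ^ t" using b(1) tt by (intro power_increasing) auto
    then have lt: "4 * (2 + c2) < b ^ t" using n1 by linarith
    have l1: "1 < b ^ t" using b(1) tt by (simp add: one_less_power)
    have l36: "(b ^ t) ^ 36 = 2 ^ t" unfolding b(2)[symmetric] by (simp add: power_mult[symmetric] mult.commute)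
    have "1 / (b ^ t) ^ 40 \<le> \<Psi> t" using pos[of "2 ^ t"] unfolding \<Psi>_def by simp
    then show "covered (S t) (m t)"
      unfolding S_def m_def by (intro covered_dyadic_block[OF c3 l1 lt l36 _ \<Psi>1[OF tt(2)]])
    show "0 \<le> m t"
    proof -
      have "0 \<le> dyadic_const" unfolding dyadic_const_def using le c1 c12
        by (intro add_nonneg_nonneg mult_nonneg_nonneg) auto
      moreover have "0 \<le> \<Psi> t" using pos[of "2 ^ t"] b(1) unfolding \<Psi>_def by (intro add_nonneg_nonneg) auto
      ultimately show ?thesis unfolding m_def using c3 curve_const_nonneg b(1)
        by (intro add_nonneg_nonneg mult_nonneg_nonneg divide_nonneg_pos) auto
    qed
  next
    fix x assume x: "x \<in> mult_approx_set {\<alpha>..\<beta>} f \<psi>"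
    let ?A = "{q::nat. 1 \<le> q \<and> dist_nearest_int (real q * x) * dist_nearest_int (real q * f x) < \<psi> q}"
    have xJ: "x \<in> {\<alpha>..\<beta>}" and inf: "infinite ?A" using x unfolding mult_approx_set_def by auto
    show "infinite {t. x \<in> S t}"
    proof
      assume "finite {t. x \<in> S t}"
      then have "finite (\<Union>t\<in>{t. x \<in> S t}. {..<2 ^ Suc t :: nat})" by blast
      moreover have "?A \<subseteq> (\<Union>t\<in>{t. x \<in> S t}. {..<2 ^ Suc t})"
      proof
        fix q assume q: "q \<in> ?A"
        obtain t where t: "2 ^ t \<le> q" "q < 2 ^ (t + 1)" using ex_power_ivl1[of 2 q] q by auto
        have "\<psi> q \<le> \<psi> (2 ^ t)" using q t(1) by (intro monotone_onD[OF mono]) auto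
        also have "\<dots> \<le> \<Psi> t" using b(1) unfolding \<Psi>_def by simp
        finally have "x \<in> S t" unfolding S_def using xJ q t by auto
        then show "q \<in> (\<Union>t\<in>{t. x \<in> S t}. {..<2 ^ Suc t})" using t(2) by auto
      qed
      ultimately show False using inf finite_subset by blast
    qed
  qed (rule \<open>summable m\<close>)
qed

end

section \<open>Limits of convex functions and the local argument\<close>

lemma nondecreasing_within:
  fixes F F' :: "real \<Rightarrow> real"
  assumes der: "\<And>z. z \<in> {u..v} \<Longrightarrow> (F has_real_derivative F' z) (at z within {u..v})"
    and pq: "u \<le> p" "p \<le> q" "q \<le> v" and nonneg: "\<And>z. p \<le> z \<Longrightarrow> z \<le> q \<Longrightarrow> 0 \<le> F' z"
  shows "F p \<le> F q"
proof (cases "p = q")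
  case False
  then have "p < q" using pq by simp
  have "(F has_derivative (\<lambda>d. F' z * d)) (at z within {p..q})" if "p \<le> z" "z \<le> q" for z
  proof -
    have "(F has_real_derivative F' z) (at z within {p..q})"
      by (rule DERIV_subset[OF der]) (use that pq in auto)
    then show ?thesis by (simp add: has_field_derivative_def)
  qed
  then obtain z where "z \<in> {p<..<q}" "F q - F p = F' z * (q - p)"
    using mvt_simple[OF \<open>p < q\<close>, of F "\<lambda>z d. F' z * d"] by auto
  moreover have "0 \<le> F' z * (q - p)" using calculation(1) nonneg[of z] by auto
  ultimately show ?thesis by linarith
qed simp

text \<open>Subtracting the quadratic expansion at \<open>x\<close> leaves a function whose
  derivative has the sign of \<open>z - x\<close>, so it is minimal at \<open>x\<close>. A negative
  \<open>m\<close> is allowed, which later yields the upper bound.\<close>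

lemma second_order_lower_bound:
  fixes G G' G'' :: "real \<Rightarrow> real"
  assumes der: "\<And>z. z \<in> {u..v} \<Longrightarrow> (G has_real_derivative G' z) (at z within {u..v})"
    and der': "\<And>z. z \<in> {u..v} \<Longrightarrow> (G' has_real_derivative G'' z) (at z within {u..v})"
    and m: "\<And>z. z \<in> {u..v} \<Longrightarrow> m \<le> G'' z"
    and x: "x \<in> {u..v}" and y: "y \<in> {u..v}"
  shows "G' x * (y - x) + m / 2 * (y - x)\<^sup>2 \<le> G y - G x"
proof -
  have mono: "G' p - m * p \<le> G' q - m * q" if "u \<le> p" "p \<le> q" "q \<le> v" for p q
    by (rule nondecreasing_within[where F = "\<lambda>z. G' z - m * z" and F' = "\<lambda>z. G'' z - m" and u = u and v = v])
       (use that m in \<open>auto intro!: derivative_eq_intros der'\<close>)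
  define F where "F z = G z - G' x * (z - x) - m / 2 * (z - x)\<^sup>2" for z
  have dF: "(F has_real_derivative (G' z - G' x - m * (z - x))) (at z within {u..v})" if "z \<in> {u..v}" for z
    unfolding F_def using that by (auto intro!: derivative_eq_intros der)
  have "F x \<le> F y"
  proof (cases "x \<le> y")
    case True
    show ?thesis
    proof (rule nondecreasing_within[OF dF])
      fix z assume z: "x \<le> z" "z \<le> y"
      then show "0 \<le> G' z - G' x - m * (z - x)" using mono[of x z] x y by (auto simp: algebra_simps)
    qed (use x y True in auto)
  next
    case False
    have "- F y \<le> - F x"
    proof (rule nondecreasing_within[where F = "\<lambda>z. - F z" and F' = "\<lambda>z. - (G' z - G' x - m * (z - x))"])
      show "((\<lambda>z. - F z) has_real_derivative - (G' z - G' x - m * (z - x))) (at z within {u..v})" if "z \<in> {u..v}" for z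
        by (rule DERIV_minus[OF dF[OF that]])
      show "0 \<le> - (G' z - G' x - m * (z - x))" if "y \<le> z" "z \<le> x" for z
        using mono[of z x] x y that by (auto simp: algebra_simps)
    qed (use x y False in auto)
    then show ?thesis by simp
  qed
  then show ?thesis unfolding F_def by simp
qed

text \<open>The bounds of \<open>convex_arc\<close> as a predicate, so that they can be stated for
  approximating functions and carried to the limit.\<close>

definition convex_with_slope :: "real \<Rightarrow> real \<Rightarrow> real \<Rightarrow> real \<Rightarrow> (real \<Rightarrow> real) \<Rightarrow> (real \<Rightarrow> real) \<Rightarrow> bool"
  where "convex_with_slope u v c1 c2 f h \<longleftrightarrow> (\<forall>x\<in>{u..v}. \<forall>y\<in>{u..v}.
    h x * (y - x) + c1 / 2 * (y - x)\<^sup>2 \<le> f y - f x \<and> f y - f x \<le> h x * (y - x) + c2 / 2 * (y - x)\<^sup>2)"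

text \<open>The continuous second derivative stays away from 0, so by the intermediate value
  property it keeps one sign, which \<open>\<sigma>\<close> makes positive.\<close>

lemma C2_class_convex_with_slope:
  assumes "g \<in> C2_class {u..v} c1 c2" "0 < c1"
  shows "\<exists>\<sigma> g'. (\<sigma> = 1 \<or> \<sigma> = -1) \<and> convex_with_slope u v c1 c2 (\<lambda>x. \<sigma> * g x) g'"
proof -
  obtain g' g'' where d: "\<And>x. x \<in> {u..v} \<Longrightarrow> (g has_real_derivative g' x) (at x within {u..v})"
      "\<And>x. x \<in> {u..v} \<Longrightarrow> (g' has_real_derivative g'' x) (at x within {u..v})"
    and cont: "continuous_on {u..v} g''"
    and b: "\<And>x. x \<in> {u..v} \<Longrightarrow> c1 \<le> \<bar>g'' x\<bar>" "\<And>x. x \<in> {u..v} \<Longrightarrow> \<bar>g'' x\<bar> \<le> c2"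
    using assms(1) unfolding C2_class_def by blast
  have "\<exists>\<sigma>::real. (\<sigma> = 1 \<or> \<sigma> = -1) \<and> (\<forall>x\<in>{u..v}. \<sigma> * g'' x > 0)"
  proof (rule ccontr)
    assume neg: "\<not> ?thesis"
    then obtain x where x: "x \<in> {u..v}" "g'' x \<le> 0" by (metis mult_1 not_le)
    have "\<exists>y\<in>{u..v}. - g'' y \<le> 0" using neg by (metis mult_minus1 not_le)
    then obtain y where y: "y \<in> {u..v}" "- g'' y \<le> 0" by blast
    have "connected (g'' ` {u..v})" using cont by (rule connected_continuous_image) simp
    then have "0 \<in> g'' ` {u..v}" by (rule connectedD_interval[of _ "g'' x" "g'' y"]) (use x y in auto)
    then obtain z where "z \<in> {u..v}" "g'' z = 0" by auto
    then show False using b(1)[of z] assms(2) by simp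
  qed
  then obtain \<sigma> :: real where \<sigma>: "\<sigma> = 1 \<or> \<sigma> = -1" "\<And>x. x \<in> {u..v} \<Longrightarrow> \<sigma> * g'' x > 0" by blast
  have bd: "c1 \<le> \<sigma> * g'' x" "- c2 \<le> - \<sigma> * g'' x" if "x \<in> {u..v}" for x
    using b[OF that] \<sigma>(1) \<sigma>(2)[OF that] by auto
  have "convex_with_slope u v c1 c2 (\<lambda>x. \<sigma> * g x) (\<lambda>x. \<sigma> * g' x)"
    unfolding convex_with_slope_def
  proof (intro ballI conjI)
    fix x y assume xy: "x \<in> {u..v}" "y \<in> {u..v}"
    show "\<sigma> * g' x * (y - x) + c1 / 2 * (y - x)\<^sup>2 \<le> \<sigma> * g y - \<sigma> * g x"
      by (rule second_order_lower_bound[where G'' = "\<lambda>x. \<sigma> * g'' x", OF _ _ bd(1) xy])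
         (auto intro!: DERIV_cmult d)
    \<comment> \<open>The lower bound for the negated function, with \<open>m = - c2\<close>, is the
      upper bound.\<close>
    have "- \<sigma> * g' x * (y - x) + - c2 / 2 * (y - x)\<^sup>2 \<le> - \<sigma> * g y - - \<sigma> * g x"
      by (rule second_order_lower_bound[where G'' = "\<lambda>x. - \<sigma> * g'' x", OF _ _ bd(2) xy])
         (rule DERIV_cmult[OF d(1)], assumption, rule DERIV_cmult[OF d(2)], assumption+)
    then show "\<sigma> * g y - \<sigma> * g x \<le> \<sigma> * g' x * (y - x) + c2 / 2 * (y - x)\<^sup>2" by simp
  qed
  then show ?thesis using \<sigma>(1) by blast
qed

text \<open>The bounds are applied towards the farther endpoint, at distance at least half the
  length. The result depends only on \<open>B\<close>, \<open>c2\<close> and the interval, which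
  gives compactness of the slopes of an approximating sequence.\<close>

lemma slope_bound:
  assumes "convex_with_slope u v c1 c2 g h" "u < v" "0 \<le> c1" "0 \<le> c2" "\<And>x. x \<in> {u..v} \<Longrightarrow> \<bar>g x\<bar> \<le> B" "x \<in> {u..v}"
  shows "\<bar>h x\<bar> \<le> 2 * (2 * B + c2 / 2 * (v - u)\<^sup>2) / (v - u)"
proof -
  define y where "y = (if x \<le> (u + v) / 2 then v else u)"
  have y: "y \<in> {u..v}" "(v - u) / 2 \<le> \<bar>y - x\<bar>" "\<bar>y - x\<bar> \<le> v - u"
    using assms(2,6) unfolding y_def by (auto simp: abs_if field_simps)
  have "(y - x)\<^sup>2 \<le> (v - u)\<^sup>2" using y(3) assms(2) by (simp add: abs_le_square_iff[symmetric])
  then have "c2 / 2 * (y - x)\<^sup>2 \<le> c2 / 2 * (v - u)\<^sup>2" using assms(4) by (intro mult_left_mono) auto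
  moreover have "0 \<le> c1 / 2 * (y - x)\<^sup>2" "0 \<le> c2 / 2 * (y - x)\<^sup>2" using assms(3,4) by auto
  moreover have "h x * (y - x) + c1 / 2 * (y - x)\<^sup>2 \<le> g y - g x" "g y - g x \<le> h x * (y - x) + c2 / 2 * (y - x)\<^sup>2"
    using assms(1,6) y(1) unfolding convex_with_slope_def by blast+
  ultimately have "\<bar>h x * (y - x)\<bar> \<le> 2 * B + c2 / 2 * (v - u)\<^sup>2"
    using assms(5)[OF assms(6)] assms(5)[OF y(1)] by linarith
  moreover have "\<bar>h x\<bar> * ((v - u) / 2) \<le> \<bar>h x * (y - x)\<bar>"
    unfolding abs_mult using y(2) by (intro mult_left_mono) auto
  ultimately have "\<bar>h x\<bar> * ((v - u) / 2) \<le> 2 * B + c2 / 2 * (v - u)\<^sup>2" by linarith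
  then show ?thesis using assms(2) by (simp add: field_simps)
qed

text \<open>The slopes of the approximants are bounded at each point, and any accumulation point of
  them is a slope for the limit because the inequalities are closed.\<close>

lemma C2_class_closure_convex_with_slope:
  assumes "restrict f {u..v} \<in> C2_class_closure {u..v} c1 c2" "u < v" "0 < c1" "c1 \<le> c2"
  obtains \<sigma> h where "\<sigma> = 1 \<or> \<sigma> = -1" "convex_with_slope u v c1 c2 (\<lambda>x. \<sigma> * f x) h"
proof -
  have cont: "continuous_on {u..v} f"
    and appr: "\<And>e. e > 0 \<Longrightarrow> \<exists>g\<in>C2_class {u..v} c1 c2. \<forall>x\<in>{u..v}. \<bar>f x - g x\<bar> \<le> e"
    using assms(1,2) C2_class_closure_iff[of "{u..v}" f c1 c2] by auto
  have appr': "\<exists>\<sigma> g g'. (\<sigma> = 1 \<or> \<sigma> = -1) \<and> (\<forall>x\<in>{u..v}. \<bar>\<sigma> * f x - g x\<bar> \<le> e) \<and> convex_with_slope u v c1 c2 g g'"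
    if e: "e > 0" for e
  proof -
    obtain g where g: "g \<in> C2_class {u..v} c1 c2" "\<forall>x\<in>{u..v}. \<bar>f x - g x\<bar> \<le> e" using appr[OF e] by blast
    obtain \<sigma> g' where s: "\<sigma> = 1 \<or> \<sigma> = -1" "convex_with_slope u v c1 c2 (\<lambda>x. \<sigma> * g x) g'"
      using C2_class_convex_with_slope[OF g(1) assms(3)] by blast
    have "\<forall>x\<in>{u..v}. \<bar>\<sigma> * f x - \<sigma> * g x\<bar> \<le> e"
      using g(2) s(1) by (auto simp: abs_minus_commute)
    then show ?thesis using s
      by (intro exI[of _ \<sigma>] exI[of _ "\<lambda>x. \<sigma> * g x"] exI[of _ g'] conjI)
  qed
  \<comment> \<open>The sign may vary with the approximant. If each sign failed at some precision,
    both would fail at the smaller of the two.\<close>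
  have "\<exists>\<sigma>::real. (\<sigma> = 1 \<or> \<sigma> = -1) \<and> (\<forall>e>0. \<exists>g g'. (\<forall>x\<in>{u..v}. \<bar>\<sigma> * f x - g x\<bar> \<le> e) \<and> convex_with_slope u v c1 c2 g g')"
  proof (rule ccontr)
    assume neg: "\<not> ?thesis"
    obtain e1 where e1: "e1 > 0" "\<not> (\<exists>g g'. (\<forall>x\<in>{u..v}. \<bar>1 * f x - g x\<bar> \<le> e1) \<and> convex_with_slope u v c1 c2 g g')"
      using neg by blast
    obtain e2 where e2: "e2 > 0" "\<not> (\<exists>g g'. (\<forall>x\<in>{u..v}. \<bar>-1 * f x - g x\<bar> \<le> e2) \<and> convex_with_slope u v c1 c2 g g')"
      using neg by blast
    have "min e1 e2 > 0" using e1 e2 by simp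
    from appr'[OF this] obtain \<sigma> g g' where s: "\<sigma> = 1 \<or> \<sigma> = -1"
      "\<forall>x\<in>{u..v}. \<bar>\<sigma> * f x - g x\<bar> \<le> min e1 e2" "convex_with_slope u v c1 c2 g g'" by blast
    from s(1) show False
    proof
      assume "\<sigma> = 1"
      then have "\<forall>x\<in>{u..v}. \<bar>1 * f x - g x\<bar> \<le> e1" using s(2) by auto
      then show False using e1(2) s(3) by blast
    next
      assume "\<sigma> = -1"
      then have "\<forall>x\<in>{u..v}. \<bar>-1 * f x - g x\<bar> \<le> e2" using s(2) by auto
      then show False using e2(2) s(3) by blast
    qed
  qed
  then obtain \<sigma> :: real where \<sigma>: "\<sigma> = 1 \<or> \<sigma> = -1"
    and ex: "\<And>e. e > 0 \<Longrightarrow> \<exists>g g'. (\<forall>x\<in>{u..v}. \<bar>\<sigma> * f x - g x\<bar> \<le> e) \<and> convex_with_slope u v c1 c2 g g'" by blast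
  have "\<exists>g g'. (\<forall>x\<in>{u..v}. \<bar>\<sigma> * f x - g x\<bar> \<le> inverse (real (Suc n))) \<and> convex_with_slope u v c1 c2 g g'" for n
    by (rule ex) simp
  then obtain g g' where g: "\<And>n x. x \<in> {u..v} \<Longrightarrow> \<bar>\<sigma> * f x - g n x\<bar> \<le> inverse (real (Suc n))"
    and g': "\<And>n. convex_with_slope u v c1 c2 (g n) (g' n)" by metis
  have lim: "(\<lambda>n. g n x) \<longlonglongrightarrow> \<sigma> * f x" if "x \<in> {u..v}" for x
  proof (rule LIM_zero_cancel, rule Lim_null_comparison[OF _ LIMSEQ_inverse_real_of_nat])
    show "\<forall>\<^sub>F n in sequentially. norm (g n x - \<sigma> * f x) \<le> inverse (real (Suc n))"
      using g[OF that] by (simp add: abs_minus_commute)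
  qed
  obtain B where B: "\<And>x. x \<in> {u..v} \<Longrightarrow> \<bar>f x\<bar> \<le> B"
  proof -
    have "bounded (f ` {u..v})" using cont by (intro compact_imp_bounded compact_continuous_image) auto
    then obtain B where "\<forall>x\<in>{u..v}. \<bar>f x\<bar> \<le> B" unfolding bounded_iff by auto
    then show ?thesis by (intro that) blast
  qed
  have gB: "\<bar>g n x\<bar> \<le> B + 1" if "x \<in> {u..v}" for n x
  proof -
    have "inverse (real (Suc n)) \<le> 1" by (simp add: field_simps)
    moreover have "\<bar>\<sigma> * f x\<bar> \<le> B" using \<sigma> B[OF that] by auto
    ultimately show ?thesis using g[OF that, of n] by linarith
  qed
  \<comment> \<open>The subsequence may depend on \<open>x\<close>: only the inequalities based at
    \<open>x\<close> are needed for the value \<open>s\<close>.\<close>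
  have "\<exists>s. \<forall>y\<in>{u..v}. s * (y - x) + c1 / 2 * (y - x)\<^sup>2 \<le> \<sigma> * f y - \<sigma> * f x \<and>
      \<sigma> * f y - \<sigma> * f x \<le> s * (y - x) + c2 / 2 * (y - x)\<^sup>2" if x: "x \<in> {u..v}" for x
  proof -
    have "\<bar>g' n x\<bar> \<le> 2 * (2 * (B + 1) + c2 / 2 * (v - u)\<^sup>2) / (v - u)" for n
      by (rule slope_bound[OF g' assms(2) _ _ gB x]) (use assms in auto)
    then have "bounded (range (\<lambda>n. g' n x))" unfolding bounded_iff by auto
    then obtain s r where r: "strict_mono r" and s: "((\<lambda>n. g' n x) \<circ> r) \<longlonglongrightarrow> s"
      using bounded_imp_convergent_subsequence[of "\<lambda>n. g' n x"] by blast
    have s': "(\<lambda>n. g' (r n) x) \<longlonglongrightarrow> s" using s by (simp add: o_def)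
    have lim': "(\<lambda>n. g (r n) y) \<longlonglongrightarrow> \<sigma> * f y" if "y \<in> {u..v}" for y
      using LIMSEQ_subseq_LIMSEQ[OF lim[OF that] r] by (simp add: o_def)
    show ?thesis
    proof (intro exI[of _ s] ballI conjI)
      fix y assume y: "y \<in> {u..v}"
      have q: "g' (r n) x * (y - x) + c1 / 2 * (y - x)\<^sup>2 \<le> g (r n) y - g (r n) x"
        "g (r n) y - g (r n) x \<le> g' (r n) x * (y - x) + c2 / 2 * (y - x)\<^sup>2" for n
        using g'[of "r n"] x y unfolding convex_with_slope_def by blast+
      show "s * (y - x) + c1 / 2 * (y - x)\<^sup>2 \<le> \<sigma> * f y - \<sigma> * f x"
        by (rule LIMSEQ_le[OF tendsto_add[OF tendsto_mult[OF s' tendsto_const] tendsto_const]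
              tendsto_diff[OF lim'[OF y] lim'[OF x]]]) (use q in blast)
      show "\<sigma> * f y - \<sigma> * f x \<le> s * (y - x) + c2 / 2 * (y - x)\<^sup>2"
        by (rule LIMSEQ_le[OF tendsto_diff[OF lim'[OF y] lim'[OF x]]
              tendsto_add[OF tendsto_mult[OF s' tendsto_const] tendsto_const]]) (use q in blast)
    qed
  qed
  then obtain h where "\<And>x y. x \<in> {u..v} \<Longrightarrow> y \<in> {u..v} \<Longrightarrow> h x * (y - x) + c1 / 2 * (y - x)\<^sup>2 \<le> \<sigma> * f y - \<sigma> * f x \<and>
      \<sigma> * f y - \<sigma> * f x \<le> h x * (y - x) + c2 / 2 * (y - x)\<^sup>2" by metis
  then have "convex_with_slope u v c1 c2 (\<lambda>x. \<sigma> * f x) h" unfolding convex_with_slope_def by blast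
  then show ?thesis using \<sigma> that by blast
qed

section \<open>Localisation away from critical points\<close>

lemma mult_approx_set_sign:
  assumes "\<sigma> = 1 \<or> \<sigma> = -1"
  shows "mult_approx_set I (\<lambda>x. \<sigma> * f x) \<psi> = mult_approx_set I f \<psi>"
  using assms unfolding mult_approx_set_def by (auto simp: dist_nearest_int_minus)

text \<open>The slope is nondecreasing, so its sign at one endpoint keeps it away from 0 on the
  whole interval; convexity then makes \<open>f\<close> expand distances by at least
  \<open>c3\<close>.\<close>

lemma mult_approx_set_null_of_slope:
  assumes "convex_with_slope p q c1 c2 f h" "p \<le> q" "0 < c1" "c1 \<le> c2" "0 < h p \<or> h q < 0"
    and pos: "\<And>q. 1 \<le> q \<Longrightarrow> 0 < \<psi> q" and mono: "antimono_on {1..} \<psi>"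
    and sum: "summable (\<lambda>n. \<psi> (Suc n) * ln (real (Suc n)))"
  shows "mult_approx_set {p..q} f \<psi> \<in> null_sets lebesgue"
proof -
  interpret convex_arc f h p q c1 c2
    using assms(1-4) unfolding convex_with_slope_def by unfold_locales auto
  have hmono: "h x \<le> h y" if "x \<in> {p..q}" "y \<in> {p..q}" "x < y" for x y
  proof -
    have "0 \<le> c1 / 2 * (y - x)\<^sup>2" "0 \<le> c1 / 2 * (x - y)\<^sup>2" using assms(3) by auto
    then have "h x * (y - x) \<le> f y - f x" "h y * (x - y) \<le> f x - f y"
      using lower[OF that(1,2)] lower[OF that(2,1)] by linarith+
    moreover have "h y * (x - y) = - (h y * (y - x))" by (simp add: algebra_simps)
    ultimately have "h x * (y - x) \<le> h y * (y - x)" by linarith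
    then show ?thesis using that(3) by simp
  qed
  define c3 where "c3 = (if 0 < h p then h p else - h q)"
  have c3: "0 < c3" using assms(5) unfolding c3_def by auto
  have inc: "c3 * (y - x) \<le> \<bar>f x - f y\<bar>" if xy: "x \<in> {p..q}" "y \<in> {p..q}" "x < y" for x y
  proof -
    have s: "0 \<le> c1 / 2 * (y - x)\<^sup>2" "0 \<le> c1 / 2 * (x - y)\<^sup>2" using assms(3) by auto
    show ?thesis
    proof (cases "0 < h p")
      case True
      have "h p \<le> h x" using hmono[of p x] xy by (cases "x = p") auto
      then have "h p * (y - x) \<le> h x * (y - x)" using xy by (intro mult_right_mono) auto
      then show ?thesis using lower[OF xy(1,2)] s True unfolding c3_def by simp
    next
      case False
      have "h y \<le> h q" using hmono[of y q] xy by (cases "y = q") auto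
      then have "- h q * (y - x) \<le> - h y * (y - x)" using xy by (intro mult_right_mono) auto
      moreover have "- h y * (y - x) = h y * (x - y)" by (simp add: algebra_simps)
      ultimately show ?thesis using lower[OF xy(2,1)] s False unfolding c3_def by simp
    qed
  qed
  have "c3 * \<bar>x - y\<bar> \<le> \<bar>f x - f y\<bar>" if "x \<in> {p..q}" "y \<in> {p..q}" for x y
    using inc[of x y] inc[of y x] that by (cases x y rule: linorder_cases) (auto simp: abs_minus_commute)
  then show ?thesis by (rule mult_approx_set_null[OF c3 _ pos mono sum])
qed

lemma convex_with_slope_subinterval:
  assumes "convex_with_slope u v c1 c2 f h" "u \<le> p" "q \<le> v"
  shows "convex_with_slope p q c1 c2 f h"
  using assms unfolding convex_with_slope_def by auto

text \<open>The slope separates points by a factor \<open>c1\<close>, so it vanishes at most once.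
  That point is null, and around every other point the slope keeps its sign.\<close>

lemma mult_approx_set_null_open:
  assumes cv: "convex_with_slope u v c1 c2 f h" "0 < c1" "c1 \<le> c2"
    and pos: "\<And>q. 1 \<le> q \<Longrightarrow> 0 < \<psi> q" and mono: "antimono_on {1..} \<psi>"
    and sum: "summable (\<lambda>n. \<psi> (Suc n) * ln (real (Suc n)))"
  shows "mult_approx_set {u<..<v} f \<psi> \<in> null_sets lebesgue"
proof -
  let ?S = "mult_approx_set {u<..<v} f \<psi>"
  let ?Z = "{x \<in> {u<..<v}. h x = 0}"
  have lip: "\<bar>h y - h x\<bar> \<le> c2 * \<bar>y - x\<bar> \<and> c1 * \<bar>y - x\<bar> \<le> \<bar>h y - h x\<bar>" if "x \<in> {u<..<v}" "y \<in> {u<..<v}" for x y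
  proof -
    interpret convex_arc f h u v c1 c2
      using cv that unfolding convex_with_slope_def by unfold_locales auto
    have xy: "x \<in> {u..v}" "y \<in> {u..v}" using that by auto
    have "c1 * (y - x)\<^sup>2 \<le> (h y - h x) * (y - x)"
      using lower[OF xy] lower[OF xy(2,1)] by (simp add: algebra_simps power2_eq_square)
    also have "\<dots> \<le> \<bar>h y - h x\<bar> * \<bar>y - x\<bar>" by (metis abs_ge_self abs_mult)
    finally have "c1 * \<bar>y - x\<bar> * \<bar>y - x\<bar> \<le> \<bar>h y - h x\<bar> * \<bar>y - x\<bar>"
      by (simp add: power2_eq_square mult.assoc)
    then show ?thesis using slope_lipschitz[OF xy] by (cases "y = x") auto
  qed
  have "?Z \<in> null_sets lebesgue"
  proof -
    have "x = y" if "x \<in> ?Z" "y \<in> ?Z" for x y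
      using lip[of x y] that cv(2) by (auto simp: mult_le_0_iff)
    then have "?Z = {} \<or> (\<exists>z. ?Z = {z})" by blast
    then have "finite ?Z" by (metis finite.simps)
    then have "?Z \<in> null_sets lborel" by (rule finite_imp_null_set_lborel)
    then show ?thesis by (rule null_sets_completionI)
  qed
  moreover have "?S - ?Z \<in> null_sets lebesgue"
  proof (rule locally_null)
    fix x assume x: "x \<in> ?S - ?Z"
    then have xI: "u < x" "x < v" "h x \<noteq> 0" unfolding mult_approx_set_def by auto
    \<comment> \<open>By the Lipschitz bound, the slope changes by at most \<open>c2 * e\<close>,
      less than its absolute value at \<open>x\<close>, and the interval stays inside
      \<open>(u, v)\<close>.\<close>
    define e where "e = min (\<bar>h x\<bar> / (2 * c2)) (min (x - u) (v - x) / 2)"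
    have c2: "0 < c2" using cv by linarith
    have e: "0 < e" "u < x - e" "x + e < v" "c2 * e < \<bar>h x\<bar>"
    proof -
      show "0 < e" unfolding e_def using xI c2 by simp
      have "e \<le> (x - u) / 2" "e \<le> (v - x) / 2" unfolding e_def by (auto simp: min_def)
      then show "u < x - e" "x + e < v" using xI by (auto simp: field_simps)
      have "c2 * e \<le> c2 * (\<bar>h x\<bar> / (2 * c2))" unfolding e_def using c2 by (intro mult_left_mono) auto
      also have "\<dots> < \<bar>h x\<bar>" using c2 xI(3) by simp
      finally show "c2 * e < \<bar>h x\<bar>" .
    qed
    have "\<bar>h (x - e) - h x\<bar> \<le> c2 * e" "\<bar>h (x + e) - h x\<bar> \<le> c2 * e"
      using lip[of x "x - e"] lip[of x "x + e"] e xI by auto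
    then have "0 < h (x - e) \<or> h (x + e) < 0" using e(4) by linarith
    then have "mult_approx_set {x - e..x + e} f \<psi> \<in> null_sets lebesgue"
      using e cv convex_with_slope_subinterval[OF cv(1), of "x - e" "x + e"]
      by (intro mult_approx_set_null_of_slope[OF _ _ cv(2,3) _ pos mono sum]) auto
    moreover have "(?S - ?Z) \<inter> {x - e<..<x + e} \<subseteq> mult_approx_set {x - e..x + e} f \<psi>"
      unfolding mult_approx_set_def by auto
    ultimately have "(?S - ?Z) \<inter> {x - e<..<x + e} \<in> null_sets lebesgue"
      by (rule null_sets_completion_subset[rotated])
    then show "\<exists>U. open U \<and> x \<in> U \<and> (?S - ?Z) \<inter> U \<in> null_sets lebesgue"
      using e by (intro exI[of _ "{x - e<..<x + e}"]) auto
  qed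
  ultimately have "?Z \<union> (?S - ?Z) \<in> null_sets lebesgue" by (rule null_sets.Un)
  then show ?thesis by (rule null_sets_completion_subset[rotated]) auto
qed

text \<open>The terms stay above \<open>\<psi> 1 * ln 2\<close>. This disposes of the nondecreasing
  case of monotonicity.\<close>

lemma not_summable_mono_ln:
  fixes \<psi> :: "nat \<Rightarrow> real"
  assumes pos: "\<And>q. 1 \<le> q \<Longrightarrow> 0 < \<psi> q" and mono: "mono_on {1..} \<psi>"
  shows "\<not> summable (\<lambda>n. \<psi> (Suc n) * ln (real (Suc n)))"
proof
  assume "summable (\<lambda>n. \<psi> (Suc n) * ln (real (Suc n)))"
  then have lim: "(\<lambda>n. \<psi> (Suc n) * ln (real (Suc n))) \<longlonglongrightarrow> 0" by (rule summable_LIMSEQ_zero)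
  have "\<psi> 1 * ln 2 \<le> 0"
  proof (rule LIMSEQ_le_const[OF lim], intro exI allI impI)
    fix n :: nat assume "n \<ge> 1"
    have "\<psi> 1 \<le> \<psi> (Suc n)" by (intro mono_onD[OF mono]) auto
    moreover have "ln 2 \<le> ln (real (Suc n))" using \<open>n \<ge> 1\<close> by simp
    ultimately show "\<psi> 1 * ln 2 \<le> \<psi> (Suc n) * ln (real (Suc n))"
      using pos[of "Suc n"] by (intro mult_mono) auto
  qed
  moreover have "0 < \<psi> 1 * ln 2" using pos[of 1] by simp
  ultimately show False by simp
qed

theorem theorem6:
  fixes a b :: real and \<psi> :: "nat \<Rightarrow> real" and f :: "real \<Rightarrow> real"
  assumes "a \<le> b"
    and "\<And>q. 1 \<le> q \<Longrightarrow> 0 < \<psi> q"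
    and "mono_on {1..} \<psi> \<or> antimono_on {1..} \<psi>"
    and "weakly_nondegenerate {a..b} f"
    and "summable (\<lambda>n. \<psi> (Suc n) * ln (real (Suc n)))"
  shows "mult_approx_set {a..b} f \<psi> \<in> null_sets lebesgue"
proof -
  let ?S = "mult_approx_set {a..b} f \<psi>"
  have mono: "antimono_on {1..} \<psi>" using not_summable_mono_ln assms(2,3,5) by blast
  have "AE x in lebesgue. x \<in> {a..b} \<longrightarrow> weakly_nondegenerate_at {a..b} f x"
    using assms(4) unfolding weakly_nondegenerate_def by (subst (asm) AE_restrict_space_iff) auto
  then obtain N where N: "\<And>x. x \<in> space lebesgue - N \<Longrightarrow> x \<in> {a..b} \<longrightarrow> weakly_nondegenerate_at {a..b} f x"
    "N \<in> null_sets lebesgue"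
    by (rule AE_E3) (rule that; blast)
  have "?S - N \<in> null_sets lebesgue"
  proof (rule locally_null)
    fix x assume x: "x \<in> ?S - N"
    then have "x \<in> {a..b}" unfolding mult_approx_set_def by auto
    then have "weakly_nondegenerate_at {a..b} f x" using x N(1) by auto
    then obtain c1 c2 r where r: "0 < c1" "c1 \<le> c2" "0 < r"
      "restrict f {x - r..x + r} \<in> C2_class_closure {x - r..x + r} c1 c2"
      unfolding weakly_nondegenerate_at_def by blast
    obtain \<sigma> h where \<sigma>: "\<sigma> = 1 \<or> \<sigma> = -1" "convex_with_slope (x - r) (x + r) c1 c2 (\<lambda>x. \<sigma> * f x) h"
      using C2_class_closure_convex_with_slope[OF r(4) _ r(1,2)] r(3) by auto
    \<comment> \<open>The local result concerns \<open>\<sigma> * f\<close>; distances to the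
      nearest integer do not see the sign.\<close>
    have "mult_approx_set {x - r<..<x + r} f \<psi> \<in> null_sets lebesgue"
      using mult_approx_set_null_open[OF \<sigma>(2) r(1,2) assms(2) mono assms(5)]
      unfolding mult_approx_set_sign[OF \<sigma>(1)] .
    moreover have "(?S - N) \<inter> {x - r<..<x + r} \<subseteq> mult_approx_set {x - r<..<x + r} f \<psi>"
      unfolding mult_approx_set_def by auto
    ultimately have "(?S - N) \<inter> {x - r<..<x + r} \<in> null_sets lebesgue"
      by (rule null_sets_completion_subset[rotated])
    then show "\<exists>U. open U \<and> x \<in> U \<and> (?S - N) \<inter> U \<in> null_sets lebesgue"
      using r(3) by (intro exI[of _ "{x - r<..<x + r}"]) auto
  qed
  then have "N \<union> (?S - N) \<in> null_sets lebesgue" using N(2) by (intro null_sets.Un)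
  then show ?thesis by (rule null_sets_completion_subset[rotated]) auto
qed

end
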